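(* For every $\tau\in\mathbb C$ with $\operatorname{Im}\tau>0$, $$\oint_A\frac{P_2(2z;\tau)}{\wp'(z;\tau)^2}\,dz=\frac{G_4(\tau)\left(5G_4(\tau)-G_2(\tau)^2\right)}{30\left(20G_4(\tau)^3-49G_6(\tau)^2\right)}.$$
   Context: $\wp(z;\tau)$ is the Weierstrass function of the lattice $\Lambda=\mathbb Z+\mathbb Z\tau$; $G_{2k}(\tau)=\sum_{\omega\in\Lambda\setminus\{0\}}\omega^{-2k}$ for $k\ge2$; $G_2(\tau)=\sum_{m\ne0}m^{-2}+\sum_{n\ne0}\sum_{m\in\mathbb Z}(m+n\tau)^{-2}$ (summed in this order); $P_2(z;\tau)=\wp(z;\tau)+G_2(\tau)$. The $A$-cycle is the segment $z\in[0,1)$ shifted by $i\epsilon$ ($\epsilon>0$ small) to avoid poles, i.e. the straight path from $i\epsilon$ to $1+i\epsilon$. *)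

theory Defs
  imports "HOL-Complex_Analysis.Complex_Analysis"
begin

definition lattice :: "complex \<Rightarrow> complex set" where
  "lattice \<tau> = {of_int m + of_int n * \<tau> | m n :: int. True}"

text \<open>Indexed by the weight: the usual \<open>G\<^sub>2\<^sub>k\<close> is \<open>eisenstein_G (2 * k)\<close>. The sum converges
  absolutely only for weight at least 3; weight 2 is \<open>eisenstein_G2\<close> below.\<close>

definition eisenstein_G :: "nat \<Rightarrow> complex \<Rightarrow> complex" where
  "eisenstein_G k \<tau> = (\<Sum>\<^sub>\<infinity>\<omega>\<in>lattice \<tau> - {0}. 1 / \<omega> ^ k)"

text \<open>The double sum is only conditionally convergent, so the order of summation matters;
  for \<open>Im \<tau> > 0\<close>, each inner sum and the outer sum of their values converge absolutely.\<close>

definition eisenstein_G2 :: "complex \<Rightarrow> complex" where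
  "eisenstein_G2 \<tau> = (\<Sum>\<^sub>\<infinity>m\<in>UNIV - {0 :: int}. 1 / of_int m ^ 2)
     + (\<Sum>\<^sub>\<infinity>n\<in>UNIV - {0 :: int}. \<Sum>\<^sub>\<infinity>m\<in>(UNIV :: int set). 1 / (of_int m + of_int n * \<tau>) ^ 2)"

definition weierstrass_p :: "complex \<Rightarrow> complex \<Rightarrow> complex" where
  "weierstrass_p \<tau> z = 1 / z ^ 2 + (\<Sum>\<^sub>\<infinity>\<omega>\<in>lattice \<tau> - {0}. 1 / (z - \<omega>) ^ 2 - 1 / \<omega> ^ 2)"

definition P2 :: "complex \<Rightarrow> complex \<Rightarrow> complex" where
  "P2 \<tau> z = weierstrass_p \<tau> z + eisenstein_G2 \<tau>"

definition A_cycle :: "real \<Rightarrow> real \<Rightarrow> complex" where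
  "A_cycle \<epsilon> = linepath (\<i> * of_real \<epsilon>) (1 + \<i> * of_real \<epsilon>)"

end

theory Submission
  imports Defs
begin

text \<open>By the duplication formula \<open>\<wp>(2z) = (\<wp>''/(2\<wp>'))\<^sup>2 - 2\<wp>\<close>, the integrand is an even elliptic function
  with poles only at the half periods outside the lattice. Bezout coefficients for the cubic \<open>f\<close> with
  \<open>\<wp>'\<^sup>2 = f(\<wp>)\<close> and its derivative reduce it to \<open>a\<wp> + b\<close> modulo the derivative of an elliptic function;
  only the constants \<open>a\<close>, \<open>b\<close> contribute to the integral, because the period of \<open>\<wp>\<close> along the A-cycle is
  \<open>-G\<^sub>2\<close> by Eisenstein summation. All identities between elliptic functions follow from Liouville's
  theorem. The same theorem gives the non-vanishing of the discriminant: a double root \<open>e\<close> of \<open>f\<close> would never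
  be a value of \<open>\<wp>\<close>, so \<open>1/(\<wp> - e)\<close> would be entire and elliptic.\<close>

text \<open>Division by zero returns 0, so the formulas for elliptic functions take meaningless
  values at lattice points. Liouville's theorem is therefore stated for functions with removable
  singularities that are periodic on punctured neighbourhoods, and it concludes about limits. Write
  x = \<open>wp\<close>, y = \<open>wp'\<close>, so that y^2 = f(x) and f'(x) = 2
  \<open>wp''\<close>. The integrand is \<open>wp''\<close>^2/(4 y^4) - 2 x/y^2 +
  \<open>G2\<close>/y^2. Since (\<open>wp''\<close>/(12 y^3))' = x/y^2 - \<open>wp''\<close>^2/(4
  y^4), the poles of order four disappear at the cost of one of the two terms x/y^2. For the rest, 1
  = p f + u f'/2 gives 1/y^2 = p(x) + u'(x) - (u(x)/y)', and x/y^2 is treated alike with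
  \<open>v\<close>. With the constants \<open>a\<close>, \<open>b\<close>, \<open>d\<close> of
  \<open>primitive_has_field_derivative\<close>, modulo derivatives 1/y^2 becomes a x + b and x/y^2
  becomes -b x - d. The integral is then -(\<open>G2\<close> a + b) \<open>G2\<close> +
  \<open>G2\<close> b + d = d - a \<open>G2\<close>^2: the constant b, which carries
  \<open>G6\<close>, cancels.\<close>

lemma summable_on_int_powr:
  fixes a :: real
  assumes "a > 1"
  shows "(\<lambda>m::int. (1 + \<bar>real_of_int m\<bar>) powr -a) summable_on UNIV"
proof -
  have "summable (\<lambda>n. real n powr -a)"
    using assms by (simp add: summable_real_powr_iff)
  hence "summable (\<lambda>n. real (Suc n) powr -a)"
    by (subst summable_Suc_iff)
  hence *: "(\<lambda>n. (1 + real n) powr -a) summable_on UNIV"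
    by (subst summable_on_UNIV_nonneg_real_iff) (auto simp: add_ac)
  have "(\<lambda>m::int. (1 + \<bar>real_of_int m\<bar>) powr -a) summable_on range int"
    using * by (subst summable_on_reindex) (auto simp: o_def)
  moreover have "(\<lambda>m::int. (1 + \<bar>real_of_int m\<bar>) powr -a) summable_on range (\<lambda>n. - int n)"
    using * by (subst summable_on_reindex) (auto simp: o_def inj_on_def)
  ultimately have "(\<lambda>m::int. (1 + \<bar>real_of_int m\<bar>) powr -a) summable_on
      (range int \<union> range (\<lambda>n. - int n))"
    by (rule summable_on_union)
  moreover have "range int \<union> range (\<lambda>n. - int n) = (UNIV :: int set)"
  proof (rule equalityI[OF subset_UNIV subsetI])
    show "m \<in> range int \<union> range (\<lambda>n. - int n)" for m :: int
      by (cases m rule: int_cases2) auto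
  qed
  ultimately show ?thesis by simp
qed

lemma Times_summable_on:
  fixes f :: "'a \<Rightarrow> real" and g :: "'b \<Rightarrow> real"
  assumes "f summable_on A" "g summable_on B"
    and "\<And>x. f x \<ge> 0" "\<And>y. g y \<ge> 0"
  shows "(\<lambda>(x, y). f x * g y) summable_on A \<times> B"
proof (rule summable_on_SigmaI)
  show "((\<lambda>y. case (x, y) of (x, y) \<Rightarrow> f x * g y) has_sum f x * infsum g B) B" for x
    using assms(2) by (simp add: has_sum_cmult_right)
  show "(\<lambda>x. f x * infsum g B) summable_on A"
    using assms(1) by (rule summable_on_cmult_left)
qed (use assms in auto)

text \<open>Only the terms need a summable majorant, not their derivatives: a locally uniform limit
  of holomorphic functions may be differentiated termwise. The radius is halved because uniform
  convergence is wanted on a closed ball.\<close>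

lemma infsum_has_field_derivative:
  fixes f f' :: "'a \<Rightarrow> complex \<Rightarrow> complex"
  assumes "r > 0"
    and der: "\<And>i w. i \<in> I \<Longrightarrow> w \<in> ball z r \<Longrightarrow> (f i has_field_derivative f' i w) (at w)"
    and bound: "\<And>i w. i \<in> I \<Longrightarrow> w \<in> ball z r \<Longrightarrow> norm (f i w) \<le> M i"
    and M: "M summable_on I"
  shows "((\<lambda>w. \<Sum>\<^sub>\<infinity>i\<in>I. f i w) has_field_derivative (\<Sum>\<^sub>\<infinity>i\<in>I. f' i z)) (at z)"
proof -
  let ?F = "\<lambda>X w. \<Sum>i\<in>X. f i w"
  have sub: "cball z (r/2) \<subseteq> ball z r" using \<open>r > 0\<close> by auto
  have ulim: "uniform_limit (cball z (r/2)) ?F (\<lambda>w. \<Sum>\<^sub>\<infinity>i\<in>I. f i w) (finite_subsets_at_top I)"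
    by (rule Weierstrass_m_test_general[where M = M]) (use bound M sub in auto)
  have *: "((\<lambda>w. ?F X w) has_field_derivative (\<Sum>i\<in>X. f' i w)) (at w)"
    if "finite X" "X \<subseteq> I" "w \<in> cball z (r/2)" for X w
    by (intro DERIV_sum der) (use that sub in auto)
  have "\<forall>\<^sub>F X in finite_subsets_at_top I. continuous_on (cball z (r/2)) (?F X) \<and>
          (\<forall>w\<in>ball z (r/2). (?F X has_field_derivative (\<Sum>i\<in>X. f' i w)) (at w))"
    by (rule eventually_finite_subsets_at_top_weakI)
       (use * in \<open>auto intro!: continuous_at_imp_continuous_on DERIV_isCont\<close>)
  then obtain g' where g': "\<And>w. w \<in> ball z (r/2) \<Longrightarrow>
      ((\<lambda>w. \<Sum>\<^sub>\<infinity>i\<in>I. f i w) has_field_derivative g' w) (at w) \<and>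
      ((\<lambda>X. \<Sum>i\<in>X. f' i w) \<longlongrightarrow> g' w) (finite_subsets_at_top I)"
    using has_complex_derivative_uniform_limit[OF _ ulim, of "\<lambda>X w. \<Sum>i\<in>X. f' i w"] \<open>r > 0\<close>
    by (metis finite_subsets_at_top_neq_bot half_gt_zero)
  have "((\<lambda>i. f' i z) has_sum g' z) I"
    unfolding has_sum_def using g'[of z] \<open>r > 0\<close> by simp
  hence "(\<Sum>\<^sub>\<infinity>i\<in>I. f' i z) = g' z" by (rule infsumI)
  thus ?thesis using g'[of z] \<open>r > 0\<close> by simp
qed

section \<open>Local expansions and removable singularities\<close>

text \<open>The remainder is a power times an analytic factor rather than an O-term. Cancelling
  powers of \<open>w - z\<close> in a Laurent computation is then plain field algebra, and what is
  left is visibly analytic. The factor is the shifted power series.\<close>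

lemma analytic_taylor:
  assumes "f analytic_on {z}"
  obtains g where "g analytic_on {z}" "g z = (deriv ^^ n) f z / fact n"
    "\<forall>\<^sub>F w in nhds z. f w = (\<Sum>k<n. (deriv ^^ k) f z / fact k * (w - z) ^ k) + (w - z) ^ n * g w"
proof -
  define F where "F = fps_expansion f z"
  define G where "G = fps_shift n F"
  have F: "(\<lambda>x. f (z + x)) has_fps_expansion F"
    unfolding F_def using assms by (rule analytic_at_imp_has_fps_expansion)
  have G: "eval_fps G has_fps_expansion G"
    using F by (auto simp: has_fps_expansion_def G_def)
  have "(\<lambda>x. (\<Sum>k<n. fps_nth F k * x ^ k) + x ^ n * eval_fps G x) has_fps_expansion
          (\<Sum>k<n. fps_const (fps_nth F k) * fps_X ^ k) + fps_X ^ n * G"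
    by (intro fps_expansion_intros G)
  also have "(\<Sum>k<n. fps_const (fps_nth F k) * fps_X ^ k) + fps_X ^ n * G = F"
    by (rule fps_ext) (auto simp: fps_sum_nth fps_X_power_mult_nth G_def if_distrib cong: if_cong)
  finally have "\<forall>\<^sub>F x in nhds 0. eval_fps F x = (\<Sum>k<n. fps_nth F k * x ^ k) + x ^ n * eval_fps G x"
    by (simp add: has_fps_expansion_def)
  moreover have "\<forall>\<^sub>F x in nhds 0. eval_fps F x = f (z + x)"
    using F by (simp add: has_fps_expansion_def)
  ultimately have "\<forall>\<^sub>F x in nhds 0. f (z + x) = (\<Sum>k<n. fps_nth F k * x ^ k) + x ^ n * eval_fps G x"
    by eventually_elim simp
  hence "\<forall>\<^sub>F w in nhds z. f w = (\<Sum>k<n. fps_nth F k * (w - z) ^ k) + (w - z) ^ n * eval_fps G (w - z)"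
    by (simp add: nhds_to_0'[of z] eventually_filtermap)
  moreover have "(\<lambda>w. eval_fps G (w - z)) analytic_on {z}"
    using G by (intro has_fps_expansion_imp_analytic[of _ _ G]) simp
  moreover have "fps_nth F k = (deriv ^^ k) f z / fact k" for k
    by (simp add: F_def fps_expansion_def)
  moreover have "eval_fps G (z - z) = fps_nth F n"
    by (simp add: eval_fps_at_0 G_def)
  ultimately show ?thesis
    using that[of "\<lambda>w. eval_fps G (w - z)"] by simp
qed

lemma inverse_power_has_field_derivative:
  fixes w a :: complex
  assumes "w \<noteq> a"
  shows "((\<lambda>w. 1 / (w - a) ^ k) has_field_derivative - of_nat k * (1 / (w - a) ^ Suc k)) (at w)"
proof (cases k)
  case (Suc j)
  have "w - a \<noteq> 0" using assms by simp
  have "((\<lambda>w. (w - a) ^ Suc j) has_field_derivative (1 + of_nat j) * (1 * (w - a) ^ j)) (at w)"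
    by (rule DERIV_power_Suc) (auto intro!: derivative_eq_intros)
  from DERIV_inverse_fun[OF this]
  have "((\<lambda>w. inverse ((w - a) ^ Suc j)) has_field_derivative
          - ((1 + of_nat j) * (1 * (w - a) ^ j) * inverse (((w - a) ^ Suc j) ^ Suc (Suc 0)))) (at w)"
    using \<open>w - a \<noteq> 0\<close> by simp
  also have "- ((1 + of_nat j) * (1 * (w - a) ^ j) * inverse (((w - a) ^ Suc j) ^ Suc (Suc 0))) =
               - of_nat k * (1 / (w - a) ^ Suc k)"
    using \<open>w - a \<noteq> 0\<close> unfolding Suc by (simp add: divide_simps)
  finally show ?thesis by (simp add: Suc inverse_eq_divide)
qed auto

text \<open>The value of \<open>f\<close> at \<open>z\<close> itself is deliberately ignored, since
  at a pole of one of its ingredients it is an artefact of division by zero.\<close>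

definition removable :: "(complex \<Rightarrow> complex) \<Rightarrow> complex \<Rightarrow> bool" where
  "removable f z \<longleftrightarrow> (\<exists>g. g analytic_on {z} \<and> (\<forall>\<^sub>F w in at z. f w = g w))"

lemma removableI: "g analytic_on {z} \<Longrightarrow> \<forall>\<^sub>F w in at z. f w = g w \<Longrightarrow> removable f z"
  unfolding removable_def by blast

lemma analytic_imp_removable: "f analytic_on {z} \<Longrightarrow> removable f z"
  by (rule removableI) auto

lemma eventually_at_shift:
  fixes z d :: complex
  shows "eventually P (at (z + d)) \<longleftrightarrow> eventually (\<lambda>w. P (w + d)) (at z)"
proof -
  have "at (z + d) = filtermap (\<lambda>w. w + d) (at z)"
    using filtermap_at_shift[of "-d" z] by simp
  thus ?thesis by (simp add: eventually_filtermap)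
qed

text \<open>By periodicity, one local computation settles all points congruent modulo the
  lattice.\<close>

lemma removable_shift:
  assumes "removable f (z + d)" "\<forall>\<^sub>F w in at z. f (w + d) = f w"
  shows "removable f z"
proof -
  obtain g where g: "g analytic_on {z + d}" "\<forall>\<^sub>F w in at (z + d). f w = g w"
    using assms(1) unfolding removable_def by blast
  have "(g \<circ> (\<lambda>w. w + d)) analytic_on {z}"
    by (intro analytic_on_compose_gen[OF _ g(1)] analytic_intros) auto
  moreover have "\<forall>\<^sub>F w in at z. f w = (g \<circ> (\<lambda>w. w + d)) w"
    using g(2) assms(2) unfolding eventually_at_shift by eventually_elim simp
  ultimately show ?thesis by (rule removableI)
qed

lemma analytic_at_shift:
  assumes "f analytic_on {z - d}"
  shows "(\<lambda>w. f (w - d)) analytic_on {z}"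
proof -
  have "(f \<circ> (\<lambda>w. w - d)) analytic_on {z}"
    by (intro analytic_on_compose_gen[OF _ assms] analytic_intros) auto
  thus ?thesis by (simp add: o_def)
qed

lemma analytic_at_scale:
  assumes "f analytic_on {a * z}"
  shows "(\<lambda>w. f (a * w)) analytic_on {z}"
proof -
  have "(f \<circ> (\<lambda>w. a * w)) analytic_on {z}"
    by (intro analytic_on_compose_gen[OF _ assms] analytic_intros) auto
  thus ?thesis by (simp add: o_def)
qed

lemma analytic_at_tendsto: "f analytic_on {z} \<Longrightarrow> (f \<longlongrightarrow> f z) (at z)"
  using analytic_at_imp_isCont[of f z] by (simp add: isCont_def)

section \<open>Differences and telescoping of infinite sums\<close>

lemma has_sum_diff:
  fixes f g :: "'a \<Rightarrow> complex"
  assumes "(f has_sum a) A" "(g has_sum b) A"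
  shows "((\<lambda>x. f x - g x) has_sum (a - b)) A"
proof -
  have "((\<lambda>x. - g x) has_sum - b) A" using assms(2) by (simp add: has_sum_uminus)
  from has_sum_add[OF assms(1) this] show ?thesis by simp
qed

lemma summable_on_diff:
  fixes f g :: "'a \<Rightarrow> complex"
  shows "f summable_on A \<Longrightarrow> g summable_on A \<Longrightarrow> (\<lambda>x. f x - g x) summable_on A"
  unfolding summable_on_def using has_sum_diff by blast

lemma infsum_diff:
  fixes f g :: "'a \<Rightarrow> complex"
  assumes "f summable_on A" "g summable_on A"
  shows "(\<Sum>\<^sub>\<infinity>x\<in>A. f x - g x) = infsum f A - infsum g A"
  by (intro infsumI has_sum_diff has_sum_infsum assms)

text \<open>Given summability, the sum may be evaluated along the symmetric intervals from -n to n,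
  where it collapses to two boundary terms.\<close>

lemma infsum_telescoping_int:
  fixes h :: "int \<Rightarrow> complex"
  assumes summable: "(\<lambda>m. h m - h (m - 1)) summable_on UNIV"
    and "((\<lambda>n. h (int n)) \<longlongrightarrow> 0) sequentially" "((\<lambda>n. h (- 1 - int n)) \<longlongrightarrow> 0) sequentially"
  shows "(\<Sum>\<^sub>\<infinity>m. h m - h (m - 1)) = 0"
proof -
  have sum: "(\<Sum>m\<in>{- int n..int n}. h m - h (m - 1)) = h (int n) - h (- 1 - int n)" for n
  proof (induction n)
    case (Suc n)
    have "{- int (Suc n)..int (Suc n)} = insert (- int (Suc n)) (insert (int (Suc n)) {- int n..int n})"
      by auto
    thus ?case using Suc by (simp add: algebra_simps)
  qed simp
  have "filterlim (\<lambda>n. {- int n..int n}) (finite_subsets_at_top UNIV) sequentially"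
  proof (intro filterlim_atLeastAtMost_at_bot_at_top filterlim_int_sequentially)
    show "filterlim (\<lambda>n. - int n) at_bot sequentially"
      unfolding filterlim_at_bot
    proof
      fix Z :: int
      show "\<forall>\<^sub>F n in sequentially. - int n \<le> Z"
        using eventually_ge_at_top[of "nat (- Z)"] by eventually_elim simp
    qed
  qed simp
  hence "(\<lambda>n. \<Sum>m\<in>{- int n..int n}. h m - h (m - 1)) \<longlonglongrightarrow> (\<Sum>\<^sub>\<infinity>m. h m - h (m - 1))"
    by (rule filterlim_compose[OF has_sum_infsum[OF summable, unfolded has_sum_def]])
  hence "(\<lambda>n. h (int n) - h (- 1 - int n)) \<longlonglongrightarrow> (\<Sum>\<^sub>\<infinity>m. h m - h (m - 1))"
    unfolding sum .
  moreover have "(\<lambda>n. h (int n) - h (- 1 - int n)) \<longlonglongrightarrow> 0 - 0"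
    by (intro tendsto_diff assms)
  ultimately show ?thesis using LIMSEQ_unique by fastforce
qed

text \<open>The indices \<open>int n\<close> and \<open>- 1 - int n\<close> are the two ends left by
  telescoping from -n to n: the lower one is m - 1 at m = -n.\<close>

lemma tendsto_inverse_int:
  fixes c :: complex
  shows "(\<lambda>n. 1 / (c - of_int (int n))) \<longlonglongrightarrow> 0" "(\<lambda>n. 1 / (c - of_int (- 1 - int n))) \<longlonglongrightarrow> 0"
proof -
  have *: "filterlim (\<lambda>n. c + a * of_nat n) at_infinity sequentially" if "a \<noteq> 0" for a c :: complex
  proof -
    have "filterlim (\<lambda>n. a * of_nat n) at_infinity sequentially"
      by (rule tendsto_mult_filterlim_at_infinity[OF tendsto_const that tendsto_of_nat])
    thus ?thesis by (intro tendsto_add_filterlim_at_infinity[OF tendsto_const])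
  qed
  have "(\<lambda>n. 1 / (c + (-1) * of_nat n)) \<longlonglongrightarrow> 0"
    by (rule tendsto_divide_0[OF tendsto_const *]) simp
  thus "(\<lambda>n. 1 / (c - of_int (int n))) \<longlonglongrightarrow> 0" by simp
  have "(\<lambda>n. 1 / ((c + 1) + 1 * of_nat n)) \<longlonglongrightarrow> 0"
    by (rule tendsto_divide_0[OF tendsto_const *]) simp
  thus "(\<lambda>n. 1 / (c - of_int (- 1 - int n))) \<longlonglongrightarrow> 0" by (simp add: algebra_simps)
qed

locale upper_half_plane =
  fixes \<tau> :: complex
  assumes Im_pos: "Im \<tau> > 0"
begin

subsection \<open>The lattice\<close>

abbreviation \<Lambda> :: "complex set" where "\<Lambda> \<equiv> lattice \<tau>"
abbreviation \<Lambda>0 :: "complex set" where "\<Lambda>0 \<equiv> lattice \<tau> - {0}"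

lemma lattice_0 [simp]: "0 \<in> \<Lambda>"
  and lattice_1 [simp]: "1 \<in> \<Lambda>"
  and lattice_tau [simp]: "\<tau> \<in> \<Lambda>"
  unfolding lattice_def
    apply (rule CollectI, rule exI[of _ 0], rule exI[of _ 0], simp)
   apply (rule CollectI, rule exI[of _ 1], rule exI[of _ 0], simp)
  apply (rule CollectI, rule exI[of _ 0], rule exI[of _ 1], simp)
  done

lemma lattice_add: "x \<in> \<Lambda> \<Longrightarrow> y \<in> \<Lambda> \<Longrightarrow> x + y \<in> \<Lambda>"
proof -
  assume "x \<in> \<Lambda>" "y \<in> \<Lambda>"
  then obtain a b c d :: int where "x = of_int a + of_int b * \<tau>" "y = of_int c + of_int d * \<tau>"
    unfolding lattice_def by blast
  hence "x + y = of_int (a + c) + of_int (b + d) * \<tau>" by (simp add: algebra_simps)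
  thus ?thesis unfolding lattice_def by blast
qed

lemma lattice_uminus: "x \<in> \<Lambda> \<Longrightarrow> - x \<in> \<Lambda>"
proof -
  assume "x \<in> \<Lambda>"
  then obtain a b :: int where "x = of_int a + of_int b * \<tau>"
    unfolding lattice_def by blast
  hence "- x = of_int (- a) + of_int (- b) * \<tau>" by (simp add: algebra_simps)
  thus ?thesis unfolding lattice_def by blast
qed

lemma lattice_uminus_iff [simp]: "- x \<in> \<Lambda> \<longleftrightarrow> x \<in> \<Lambda>"
  using lattice_uminus by force

lemma lattice_diff: "x \<in> \<Lambda> \<Longrightarrow> y \<in> \<Lambda> \<Longrightarrow> x - y \<in> \<Lambda>"
  using lattice_add[OF _ lattice_uminus] by fastforce

lemma lattice_add_iff [simp]: "y \<in> \<Lambda> \<Longrightarrow> x + y \<in> \<Lambda> \<longleftrightarrow> x \<in> \<Lambda>"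
  using lattice_add[of x y] lattice_diff[of "x + y" y] by auto

lemma lattice_diff_iff [simp]: "y \<in> \<Lambda> \<Longrightarrow> x - y \<in> \<Lambda> \<longleftrightarrow> x \<in> \<Lambda>"
  using lattice_add[of "x - y" y] lattice_diff[of x y] by auto

lemma bij_betw_lattice: "bij_betw (\<lambda>(m, n). of_int m + of_int n * \<tau>) (UNIV :: (int \<times> int) set) \<Lambda>"
  unfolding bij_betw_def
proof
  show "inj (\<lambda>(m::int, n::int). of_int m + of_int n * \<tau>)"
  proof (rule injI, clarsimp)
    fix a b c d :: int
    assume *: "complex_of_int a + of_int b * \<tau> = of_int c + of_int d * \<tau>"
    hence "of_int b * Im \<tau> = of_int d * Im \<tau>" by (simp add: complex_eq_iff)
    hence "b = d" using Im_pos by simp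
    thus "a = c \<and> b = d" using * by simp
  qed
  show "range (\<lambda>(m::int, n::int). of_int m + of_int n * \<tau>) = \<Lambda>"
    unfolding lattice_def by auto
qed

lemma countable_lattice: "countable \<Lambda>"
proof -
  have "\<Lambda> = (\<lambda>(m, n). of_int m + of_int n * \<tau>) ` (UNIV :: (int \<times> int) set)"
    using bij_betw_lattice by (simp add: bij_betw_def)
  thus ?thesis by (metis countableI_type countable_image)
qed

text \<open>A crude constant bounding both integer coordinates of a lattice point by its norm: the
  imaginary part controls \<open>n\<close> (summand \<open>1 / Im \<tau>\<close>), and the triangle
  inequality then controls \<open>m\<close> (the other two summands).\<close>

definition K :: real where "K = 1 + norm \<tau> / Im \<tau> + 1 / Im \<tau>"

lemma K_ge1: "K \<ge> 1" using Im_pos by (simp add: K_def)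

lemma coeffs_le:
  fixes m n :: int
  shows "\<bar>of_int m\<bar> \<le> K * norm (of_int m + of_int n * \<tau>)"
    and "\<bar>of_int n\<bar> \<le> K * norm (of_int m + of_int n * \<tau>)"
proof -
  let ?w = "of_int m + of_int n * \<tau>"
  have "\<bar>Im ?w\<bar> \<le> norm ?w" by (rule abs_Im_le_cmod)
  hence 1: "\<bar>of_int n\<bar> * Im \<tau> \<le> norm ?w" using Im_pos by (simp add: abs_mult)
  hence 2: "\<bar>of_int n\<bar> \<le> norm ?w / Im \<tau>" using Im_pos by (simp add: field_simps)
  have "norm (of_int m :: complex) \<le> norm ?w + norm (of_int n * \<tau>)"
    by (metis add_diff_cancel_right' norm_triangle_ineq4)
  hence "\<bar>of_int m\<bar> \<le> norm ?w + \<bar>of_int n\<bar> * norm \<tau>" by (simp add: norm_mult)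
  also have "\<dots> \<le> norm ?w + norm ?w / Im \<tau> * norm \<tau>"
    using 2 by (intro add_left_mono mult_right_mono) auto
  also have "\<dots> \<le> K * norm ?w"
    using Im_pos by (simp add: K_def algebra_simps)
  finally show "\<bar>of_int m\<bar> \<le> K * norm ?w" .
  have "norm ?w / Im \<tau> \<le> K * norm ?w"
    using Im_pos by (simp add: K_def algebra_simps)
  thus "\<bar>of_int n\<bar> \<le> K * norm ?w" using 2 by simp
qed

lemma norm_lattice_ge: "\<omega> \<in> \<Lambda>0 \<Longrightarrow> K * norm \<omega> \<ge> 1"
proof -
  assume a: "\<omega> \<in> \<Lambda>0"
  then obtain m n :: int where w: "\<omega> = of_int m + of_int n * \<tau>" unfolding lattice_def by blast
  with a have "m \<noteq> 0 \<or> n \<noteq> 0" by auto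
  hence "\<bar>real_of_int m\<bar> \<ge> 1 \<or> \<bar>real_of_int n\<bar> \<ge> 1" by linarith
  thus ?thesis using coeffs_le(1)[of m n] coeffs_le(2)[of n m] w by auto
qed

text \<open>Splitting the exponent as 3 = 3/2 + 3/2 bounds the term by a product of a function of
  \<open>m\<close> and a function of \<open>n\<close>, each summable over the integers because 3/2 >
  1.\<close>

lemma summable_lattice3: "(\<lambda>\<omega>. 1 / norm \<omega> ^ 3) summable_on \<Lambda>0"
proof -
  define h :: "int \<Rightarrow> real" where "h = (\<lambda>m. (1 + \<bar>real_of_int m\<bar>) powr -(3/2))"
  let ?g = "\<lambda>(m, n). of_int m + of_int n * \<tau>"
  have "(\<lambda>(m, n). h m * h n) summable_on UNIV \<times> UNIV"
    unfolding h_def by (intro Times_summable_on summable_on_int_powr) auto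
  hence "(\<lambda>x. (2 * K) ^ 3 * (case x of (m, n) \<Rightarrow> h m * h n)) summable_on UNIV"
    by (intro summable_on_cmult_right) simp
  hence "(\<lambda>x. (2 * K) ^ 3 * (case x of (m, n) \<Rightarrow> h m * h n)) summable_on -{(0,0)}"
    by (rule summable_on_subset_banach) auto
  hence "(\<lambda>x. 1 / norm (?g x) ^ 3) summable_on -{(0,0)}"
  proof (rule summable_on_comparison_test)
    fix x :: "int \<times> int" assume x: "x \<in> -{(0,0)}"
    obtain m n where mn: "x = (m, n)" by force
    let ?w = "of_int m + of_int n * \<tau>"
    have "?w \<in> \<Lambda>0" using bij_betw_lattice x mn
      by (force simp: bij_betw_def dest: injD[of _ "(m, n)" "(0, 0)"])
    hence w1: "K * norm ?w \<ge> 1" by (rule norm_lattice_ge)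
    hence wpos: "norm ?w > 0" using K_ge1 by (cases "?w = 0") auto
    \<comment> \<open>Both 1 and the absolute value of the coordinate are at most \<open>K\<close>
      times the norm, hence the factor 2.\<close>
    have "1 + \<bar>real_of_int m\<bar> \<le> 2 * K * norm ?w" "1 + \<bar>real_of_int n\<bar> \<le> 2 * K * norm ?w"
      using coeffs_le(1)[of m n] coeffs_le(2)[of n m] w1 by auto
    hence *: "(2 * K * norm ?w) powr -(3/2) \<le> h m" "(2 * K * norm ?w) powr -(3/2) \<le> h n"
      unfolding h_def by (auto intro!: powr_mono2')
    have "(2 * K * norm ?w) powr -(3/2) * (2 * K * norm ?w) powr -(3/2) \<le> h m * h n"
      by (intro mult_mono *) (auto simp: h_def)
    also have "(2 * K * norm ?w) powr -(3/2) * (2 * K * norm ?w) powr -(3/2) = (2 * K * norm ?w) powr (- 3)"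
      by (simp add: powr_add [symmetric])
    also have "\<dots> = 1 / (2 * K * norm ?w) ^ 3"
      using wpos K_ge1 by (simp add: powr_minus powr_numeral field_simps)
    finally have "1 / norm ?w ^ 3 \<le> (2 * K) ^ 3 * (h m * h n)"
      using wpos K_ge1 by (simp add: power_mult_distrib field_simps)
    thus "1 / norm (?g x) ^ 3 \<le> (2 * K) ^ 3 * (case x of (m, n) \<Rightarrow> h m * h n)" by (simp add: mn)
  qed auto
  moreover have "bij_betw ?g (-{(0,0)}) \<Lambda>0"
  proof -
    have "bij_betw ?g (UNIV - {(0,0)}) (\<Lambda> - {?g (0,0)})"
      by (rule bij_betw_DiffI[OF bij_betw_lattice]) (auto simp: bij_betw_def)
    thus ?thesis by (simp add: Compl_eq_Diff_UNIV)
  qed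
  ultimately show ?thesis using summable_on_reindex_bij_betw by fastforce
qed

lemma finite_lattice_ball: "finite {\<omega>\<in>\<Lambda>. norm (\<omega> - z) \<le> R}"
proof -
  define N where "N = \<lceil>K * (norm z + R)\<rceil>"
  have "{\<omega>\<in>\<Lambda>. norm (\<omega> - z) \<le> R} \<subseteq> (\<lambda>(m, n). of_int m + of_int n * \<tau>) ` ({-N..N} \<times> {-N..N})"
  proof safe
    fix \<omega> assume "\<omega> \<in> \<Lambda>" and R: "norm (\<omega> - z) \<le> R"
    then obtain m n :: int where w: "\<omega> = of_int m + of_int n * \<tau>" unfolding lattice_def by blast
    have "norm \<omega> \<le> norm z + R" using R by norm
    hence "K * norm \<omega> \<le> K * (norm z + R)" using K_ge1 by (intro mult_left_mono) auto
    also have "\<dots> \<le> real_of_int N" unfolding N_def by (rule le_of_int_ceiling)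
    finally have "\<bar>real_of_int m\<bar> \<le> real_of_int N" "\<bar>real_of_int n\<bar> \<le> real_of_int N"
      using coeffs_le(1)[of m n] coeffs_le(2)[of n m] unfolding w by linarith+
    thus "\<omega> \<in> (\<lambda>(m, n). of_int m + of_int n * \<tau>) ` ({-N..N} \<times> {-N..N})"
      using w by (force simp: image_iff)
  qed
  thus ?thesis by (rule finite_subset) auto
qed

lemma eventually_notin_lattice: "\<forall>\<^sub>F w in at z. w \<notin> \<Lambda>"
proof -
  have "\<not> z islimpt {\<omega>\<in>\<Lambda>. norm (\<omega> - z) \<le> 1}"
    using finite_lattice_ball by (rule islimpt_finite)
  hence "\<forall>\<^sub>F w in at z. \<not> (w \<in> \<Lambda> \<and> norm (w - z) \<le> 1)"
    by (simp add: islimpt_iff_eventually)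
  moreover have "\<forall>\<^sub>F w in at z. w \<in> ball z 1"
    by (intro eventually_at_in_open') auto
  ultimately show ?thesis
    by eventually_elim (auto simp: dist_norm norm_minus_commute)
qed

lemma closed_lattice_subset: "S \<subseteq> \<Lambda> \<Longrightarrow> closed S"
proof -
  assume "S \<subseteq> \<Lambda>"
  have "\<not> z islimpt S" for z
    unfolding islimpt_iff_eventually using eventually_notin_lattice[of z] \<open>S \<subseteq> \<Lambda>\<close>
    by (auto elim!: eventually_mono)
  thus ?thesis by (simp add: closed_limpt)
qed

text \<open>Two regimes. For \<open>norm \<omega>\<close> above 2 R the triangle inequality gives
  the factor 1/2. For the other points the distance is at least d/2, and d/(4 R) times their norm
  does not exceed that.\<close>

lemma lattice_distance_bound:
  assumes "z \<notin> \<Lambda>0"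
  obtains r c where "r > 0" "c > 0"
    "\<And>w \<omega>. w \<in> ball z r \<Longrightarrow> \<omega> \<in> \<Lambda>0 \<Longrightarrow> c * norm \<omega> \<le> norm (w - \<omega>)"
proof -
  have "open (-\<Lambda>0)" using closed_lattice_subset by blast
  then obtain d where d: "d > 0" "ball z d \<subseteq> -\<Lambda>0"
    using assms by (meson ComplI openE)
  define R where "R = norm z + d"
  define c where "c = min (1/2) (d / (4 * R))"
  have R: "R > 0" using d by (simp add: R_def add_nonneg_pos)
  show ?thesis
  proof (rule that[of "d/2" c])
    show "c > 0" using d R by (simp add: c_def)
    fix w \<omega> assume w: "w \<in> ball z (d/2)" and \<omega>: "\<omega> \<in> \<Lambda>0"
    have "dist z \<omega> \<ge> d" using d \<omega> by (meson ComplD mem_ball not_le subsetD)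
    hence 1: "norm (w - \<omega>) \<ge> d / 2" using w by (simp add: dist_norm) norm
    have "norm w \<le> R" using w d unfolding R_def by (simp add: dist_norm) norm
    hence 2: "norm (w - \<omega>) \<ge> norm \<omega> - R" by norm
    show "c * norm \<omega> \<le> norm (w - \<omega>)"
    proof (cases "norm \<omega> \<le> 2 * R")
      case True
      have "c * norm \<omega> \<le> d / (4 * R) * (2 * R)"
        using True R d by (intro mult_mono) (auto simp: c_def)
      also have "\<dots> = d / 2" using R by simp
      finally show ?thesis using 1 by simp
    next
      case False
      have "c * norm \<omega> \<le> 1/2 * norm \<omega>" by (intro mult_right_mono) (auto simp: c_def)
      thus ?thesis using 2 False by simp
    qed
  qed (use d in auto)
qed

subsection \<open>Eisenstein series and the Laurent expansion at the origin\<close>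

text \<open>The point 0 is left out, so \<open>E k\<close> is analytic at the origin for k at least
  3 and its value there is an Eisenstein series up to sign. The full lattice sum is
  \<open>1 / z ^ k + E k z\<close>.\<close>

definition E :: "nat \<Rightarrow> complex \<Rightarrow> complex" where
  "E k z = (\<Sum>\<^sub>\<infinity>\<omega>\<in>\<Lambda>0. 1 / (z - \<omega>) ^ k)"

definition A :: "complex \<Rightarrow> complex" where
  "A z = (\<Sum>\<^sub>\<infinity>\<omega>\<in>\<Lambda>0. 1 / (z - \<omega>) ^ 2 - 1 / \<omega> ^ 2)"

text \<open>The Weierstrass zeta function is \<open>1 / z + Z z\<close>.\<close>

definition Z :: "complex \<Rightarrow> complex" where
  "Z z = (\<Sum>\<^sub>\<infinity>\<omega>\<in>\<Lambda>0. 1 / (z - \<omega>) + 1 / \<omega> + z / \<omega> ^ 2)"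

lemma weierstrass_p_eq: "weierstrass_p \<tau> z = 1 / z ^ 2 + A z"
  by (simp add: weierstrass_p_def A_def)

lemma lattice_terms_bound:
  assumes "z \<notin> \<Lambda>0"
  obtains r C where "r > 0" "C \<ge> 0"
    "\<And>w \<omega>. w \<in> ball z r \<Longrightarrow> \<omega> \<in> \<Lambda>0 \<Longrightarrow> w \<noteq> \<omega>"
    "\<And>w \<omega>. w \<in> ball z r \<Longrightarrow> \<omega> \<in> \<Lambda>0 \<Longrightarrow> norm (1 / (w - \<omega>)) \<le> C / norm \<omega>"
    "\<And>w \<omega>. w \<in> ball z r \<Longrightarrow> norm w \<le> C"
proof -
  obtain r c where rc: "r > 0" "c > 0"
    "\<And>w \<omega>. w \<in> ball z r \<Longrightarrow> \<omega> \<in> \<Lambda>0 \<Longrightarrow> c * norm \<omega> \<le> norm (w - \<omega>)"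
    using lattice_distance_bound[OF assms] by metis
  have ne: "w \<noteq> \<omega>" if "w \<in> ball z r" "\<omega> \<in> \<Lambda>0" for w \<omega>
    using rc(3)[OF that] rc(2) that by (auto simp: zero_less_mult_iff mult_le_0_iff)
  show ?thesis
  proof (rule that[of r "max (1 / c) (norm z + r)"])
    fix w \<omega> assume w: "w \<in> ball z r"
    show "norm w \<le> max (1 / c) (norm z + r)"
    proof -
      have "norm (z - w) < r" using w by (simp add: dist_norm)
      hence "norm w \<le> norm z + r" by norm
      thus ?thesis by simp
    qed
    assume \<omega>: "\<omega> \<in> \<Lambda>0"
    have "norm (1 / (w - \<omega>)) = 1 / norm (w - \<omega>)" by (simp add: norm_divide)
    also have "\<dots> \<le> 1 / (c * norm \<omega>)"
      using rc(2) rc(3)[OF w \<omega>] \<omega> ne[OF w \<omega>]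
      by (intro divide_left_mono mult_pos_pos) auto
    also have "\<dots> = (1 / c) / norm \<omega>" by simp
    also have "\<dots> \<le> max (1 / c) (norm z + r) / norm \<omega>" by (intro divide_right_mono) auto
    finally show "norm (1 / (w - \<omega>)) \<le> max (1 / c) (norm z + r) / norm \<omega>" .
  qed (use rc ne in \<open>auto simp: le_max_iff_disj\<close>)
qed

lemma summable_lattice: "(\<lambda>\<omega>. C / norm \<omega> ^ 3) summable_on \<Lambda>0"
  using summable_on_cmult_right[OF summable_lattice3, of C] by simp

text \<open>Nonzero lattice points have norm at least 1/\<open>K\<close>, so every weight from 3 on
  reduces to the single summable majorant of weight 3.\<close>

lemma inverse_power_bound:
  assumes "\<omega> \<in> \<Lambda>0" "k \<ge> 3"
  shows "1 / norm \<omega> ^ k \<le> K ^ (k - 3) / norm \<omega> ^ 3"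
proof -
  have "norm \<omega> > 0" using assms by auto
  hence "1 / norm \<omega> \<le> K" using norm_lattice_ge[OF assms(1)] by (simp add: field_simps)
  hence "(1 / norm \<omega>) ^ (k - 3) * (1 / norm \<omega> ^ 3) \<le> K ^ (k - 3) * (1 / norm \<omega> ^ 3)"
    by (intro mult_right_mono power_mono) auto
  moreover have "(1 / norm \<omega>) ^ (k - 3) * (1 / norm \<omega> ^ 3) = 1 / norm \<omega> ^ k"
    using assms(2) by (simp add: power_one_over flip: power_add)
  ultimately show ?thesis by simp
qed

lemma E_term_bound:
  assumes "norm (1 / (w - \<omega>)) \<le> C / norm \<omega>" "C \<ge> 0" "\<omega> \<in> \<Lambda>0" "k \<ge> 3"
  shows "norm (1 / (w - \<omega>) ^ k) \<le> C ^ k * K ^ (k - 3) / norm \<omega> ^ 3"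
proof -
  have "norm (1 / (w - \<omega>) ^ k) = norm (1 / (w - \<omega>)) ^ k"
    by (simp add: norm_divide norm_power power_divide)
  also have "\<dots> \<le> (C / norm \<omega>) ^ k" using assms by (intro power_mono) auto
  also have "\<dots> = C ^ k * (1 / norm \<omega> ^ k)" by (simp add: power_divide)
  also have "\<dots> \<le> C ^ k * (K ^ (k - 3) / norm \<omega> ^ 3)"
    using inverse_power_bound assms by (intro mult_left_mono) auto
  finally show ?thesis by simp
qed

lemma summable_E:
  assumes "z \<notin> \<Lambda>0" "k \<ge> 3"
  shows "(\<lambda>\<omega>. 1 / (z - \<omega>) ^ k) summable_on \<Lambda>0"
proof -
  obtain r C where rC: "r > 0" "C \<ge> 0"
    "\<And>w \<omega>. w \<in> ball z r \<Longrightarrow> \<omega> \<in> \<Lambda>0 \<Longrightarrow> norm (1 / (w - \<omega>)) \<le> C / norm \<omega>"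
    using lattice_terms_bound[OF assms(1)] by metis
  have *: "norm (1 / (z - \<omega>) ^ k) \<le> C ^ k * K ^ (k - 3) / norm \<omega> ^ 3" if "\<omega> \<in> \<Lambda>0" for \<omega>
    using E_term_bound rC that assms by simp
  show ?thesis
    by (rule abs_summable_summable, rule summable_on_comparison_test[OF summable_lattice *]) auto
qed

lemma E_deriv:
  assumes "z \<notin> \<Lambda>0" "k \<ge> 3"
  shows "(E k has_field_derivative - of_nat k * E (Suc k) z) (at z)"
proof -
  obtain r C where rC: "r > 0" "C \<ge> 0"
    "\<And>w \<omega>. w \<in> ball z r \<Longrightarrow> \<omega> \<in> \<Lambda>0 \<Longrightarrow> w \<noteq> \<omega>"
    "\<And>w \<omega>. w \<in> ball z r \<Longrightarrow> \<omega> \<in> \<Lambda>0 \<Longrightarrow> norm (1 / (w - \<omega>)) \<le> C / norm \<omega>"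
    using lattice_terms_bound[OF assms(1)] by metis
  have "((\<lambda>w. \<Sum>\<^sub>\<infinity>\<omega>\<in>\<Lambda>0. 1 / (w - \<omega>) ^ k) has_field_derivative
          (\<Sum>\<^sub>\<infinity>\<omega>\<in>\<Lambda>0. - of_nat k * (1 / (z - \<omega>) ^ Suc k))) (at z)"
  proof (rule infsum_has_field_derivative[OF rC(1)])
    fix \<omega> w assume "\<omega> \<in> \<Lambda>0" "w \<in> ball z r"
    hence *: "w \<noteq> \<omega>" using rC by blast
    thus "((\<lambda>w. 1 / (w - \<omega>) ^ k) has_field_derivative
            - of_nat k * (1 / (w - \<omega>) ^ Suc k)) (at w)"
      by (rule inverse_power_has_field_derivative)
  next
    fix \<omega> w assume "\<omega> \<in> \<Lambda>0" "w \<in> ball z r"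
    thus "norm (1 / (w - \<omega>) ^ k) \<le> C ^ k * K ^ (k - 3) / norm \<omega> ^ 3"
      using E_term_bound rC assms by simp
  qed (rule summable_lattice)
  thus ?thesis unfolding E_def by (simp only: infsum_cmult_right')
qed

lemma A_deriv:
  assumes "z \<notin> \<Lambda>0"
  shows "(A has_field_derivative - 2 * E 3 z) (at z)"
proof -
  obtain r C where rC: "r > 0" "C \<ge> 0"
    "\<And>w \<omega>. w \<in> ball z r \<Longrightarrow> \<omega> \<in> \<Lambda>0 \<Longrightarrow> w \<noteq> \<omega>"
    "\<And>w \<omega>. w \<in> ball z r \<Longrightarrow> \<omega> \<in> \<Lambda>0 \<Longrightarrow> norm (1 / (w - \<omega>)) \<le> C / norm \<omega>"
    "\<And>w \<omega>. w \<in> ball z r \<Longrightarrow> norm w \<le> C"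
    using lattice_terms_bound[OF assms(1)] by metis
  have "((\<lambda>w. \<Sum>\<^sub>\<infinity>\<omega>\<in>\<Lambda>0. 1 / (w - \<omega>) ^ 2 - 1 / \<omega> ^ 2) has_field_derivative
          (\<Sum>\<^sub>\<infinity>\<omega>\<in>\<Lambda>0. - 2 * (1 / (z - \<omega>) ^ 3))) (at z)"
  proof (rule infsum_has_field_derivative[OF rC(1)])
    fix \<omega> w assume "\<omega> \<in> \<Lambda>0" "w \<in> ball z r"
    hence *: "w \<noteq> \<omega>" using rC by blast
    show "((\<lambda>w. 1 / (w - \<omega>) ^ 2 - 1 / \<omega> ^ 2) has_field_derivative
            - 2 * (1 / (w - \<omega>) ^ 3)) (at w)"
      using DERIV_diff[OF inverse_power_has_field_derivative[OF *, of 2] DERIV_const, of "1 / \<omega> ^ 2"]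
      by (simp add: eval_nat_numeral)
  next
    fix \<omega> w assume \<omega>: "\<omega> \<in> \<Lambda>0" and w: "w \<in> ball z r"
    hence *: "w \<noteq> \<omega>" using rC by blast
    have bounds: "norm ((1 / (w - \<omega>)) ^ 2 * (1 / \<omega>)) \<le> (C / norm \<omega>) ^ 2 * (1 / norm \<omega>)"
        "norm (1 / (w - \<omega>) * (1 / \<omega>) ^ 2) \<le> C / norm \<omega> * (1 / norm \<omega>) ^ 2"
      unfolding norm_mult norm_power
      using rC(2) rC(4)[OF w \<omega>]
      by (intro mult_mono power_mono; simp add: norm_divide)+
    \<comment> \<open>Difference of two squares: the factor 1/(w - \<omega>) + 1/\<omega> equals
      w/((w - \<omega>) \<omega>), which raises the decay from quadratic to cubic.\<close>
    have "1 / (w - \<omega>) ^ 2 - 1 / \<omega> ^ 2 = w * ((1 / (w - \<omega>)) ^ 2 * (1 / \<omega>) - 1 / (w - \<omega>) * (1 / \<omega>) ^ 2)"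
      using * \<omega> by (simp add: divide_simps) (simp add: power2_eq_square algebra_simps)
    also have "norm \<dots> \<le> C * ((C / norm \<omega>) ^ 2 * (1 / norm \<omega>) + C / norm \<omega> * (1 / norm \<omega>) ^ 2)"
      using rC(2,5) w bounds
      by (subst norm_mult) (intro mult_mono order.trans[OF norm_triangle_ineq4] add_mono, auto)
    also have "\<dots> = C * (C ^ 2 + C) / norm \<omega> ^ 3"
      using \<omega> by (simp add: field_simps power2_eq_square power3_eq_cube)
    finally show "norm (1 / (w - \<omega>) ^ 2 - 1 / \<omega> ^ 2) \<le> C * (C ^ 2 + C) / norm \<omega> ^ 3" .
  qed (rule summable_lattice)
  thus ?thesis unfolding E_def A_def by (simp only: infsum_cmult_right')
qed

text \<open>The added terms cancel the expansion -1/\<omega> - w/\<omega>^2 - ... of 1/(w -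
  \<omega>) through first order, leaving w^2/((w - \<omega>) \<omega>^2), of cubic decay.\<close>

lemma Z_term_bound:
  assumes "z \<notin> \<Lambda>0"
  obtains r C where "r > 0"
    "\<And>w \<omega>. w \<in> ball z r \<Longrightarrow> \<omega> \<in> \<Lambda>0 \<Longrightarrow> w \<noteq> \<omega>"
    "\<And>w \<omega>. w \<in> ball z r \<Longrightarrow> \<omega> \<in> \<Lambda>0 \<Longrightarrow>
       norm (1 / (w - \<omega>) + 1 / \<omega> + w / \<omega> ^ 2) \<le> C / norm \<omega> ^ 3"
proof -
  obtain r C where rC: "r > 0" "C \<ge> 0"
    "\<And>w \<omega>. w \<in> ball z r \<Longrightarrow> \<omega> \<in> \<Lambda>0 \<Longrightarrow> w \<noteq> \<omega>"
    "\<And>w \<omega>. w \<in> ball z r \<Longrightarrow> \<omega> \<in> \<Lambda>0 \<Longrightarrow> norm (1 / (w - \<omega>)) \<le> C / norm \<omega>"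
    "\<And>w \<omega>. w \<in> ball z r \<Longrightarrow> norm w \<le> C"
    using lattice_terms_bound[OF assms(1)] by metis
  show ?thesis
  proof (rule that[of r "C ^ 3"])
    fix \<omega> w assume \<omega>: "\<omega> \<in> \<Lambda>0" and w: "w \<in> ball z r"
    hence *: "w \<noteq> \<omega>" using rC by blast
    have "1 / (w - \<omega>) + 1 / \<omega> + w / \<omega> ^ 2 = w ^ 2 * (1 / (w - \<omega>) * (1 / \<omega>) ^ 2)"
      using * \<omega> by (simp add: divide_simps) (simp add: power2_eq_square algebra_simps)
    also have "norm \<dots> \<le> C ^ 2 * (C / norm \<omega> * (1 / norm \<omega>) ^ 2)"
      unfolding norm_mult norm_power
      using rC(2,5) w rC(4)[OF w \<omega>]
      by (intro mult_mono power_mono) (auto simp: norm_divide)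
    also have "\<dots> = C ^ 3 / norm \<omega> ^ 3"
      using \<omega> by (simp add: field_simps power2_eq_square power3_eq_cube)
    finally show "norm (1 / (w - \<omega>) + 1 / \<omega> + w / \<omega> ^ 2) \<le> C ^ 3 / norm \<omega> ^ 3" .
  qed (use rC in auto)
qed

lemma summable_Z:
  assumes "z \<notin> \<Lambda>0"
  shows "(\<lambda>\<omega>. 1 / (z - \<omega>) + 1 / \<omega> + z / \<omega> ^ 2) summable_on \<Lambda>0"
proof -
  obtain r C where rC: "r > 0" "\<And>w \<omega>. w \<in> ball z r \<Longrightarrow> \<omega> \<in> \<Lambda>0 \<Longrightarrow>
       norm (1 / (w - \<omega>) + 1 / \<omega> + w / \<omega> ^ 2) \<le> C / norm \<omega> ^ 3"
    using Z_term_bound[OF assms] by metis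
  show ?thesis
    by (rule abs_summable_summable, rule summable_on_comparison_test[OF summable_lattice[of C]])
       (use rC in auto)
qed

lemma Z_deriv:
  assumes "z \<notin> \<Lambda>0"
  shows "(Z has_field_derivative - A z) (at z)"
proof -
  obtain r C where rC: "r > 0"
    "\<And>w \<omega>. w \<in> ball z r \<Longrightarrow> \<omega> \<in> \<Lambda>0 \<Longrightarrow> w \<noteq> \<omega>"
    "\<And>w \<omega>. w \<in> ball z r \<Longrightarrow> \<omega> \<in> \<Lambda>0 \<Longrightarrow>
       norm (1 / (w - \<omega>) + 1 / \<omega> + w / \<omega> ^ 2) \<le> C / norm \<omega> ^ 3"
    using Z_term_bound[OF assms] by metis
  have "((\<lambda>w. \<Sum>\<^sub>\<infinity>\<omega>\<in>\<Lambda>0. 1 / (w - \<omega>) + 1 / \<omega> + w / \<omega> ^ 2) has_field_derivative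
          (\<Sum>\<^sub>\<infinity>\<omega>\<in>\<Lambda>0. - (1 / (z - \<omega>) ^ 2 - 1 / \<omega> ^ 2))) (at z)"
  proof (rule infsum_has_field_derivative[OF rC(1)])
    fix \<omega> w assume "\<omega> \<in> \<Lambda>0" "w \<in> ball z r"
    hence "w \<noteq> \<omega>" "\<omega> \<noteq> 0" using rC by blast+
    thus "((\<lambda>w. 1 / (w - \<omega>) + 1 / \<omega> + w / \<omega> ^ 2) has_field_derivative
            - (1 / (w - \<omega>) ^ 2 - 1 / \<omega> ^ 2)) (at w)"
      by (auto intro!: derivative_eq_intros simp: power2_eq_square)
  qed (use rC summable_lattice in auto)
  thus ?thesis unfolding Z_def A_def by (simp only: infsum_uminus)
qed

lemma bij_betw_uminus_lattice: "bij_betw uminus \<Lambda>0 \<Lambda>0"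
  by (rule bij_betwI[of _ _ _ uminus]) auto

lemma E_uminus: "E k (- z) = (- 1) ^ k * E k z"
proof -
  have *: "1 / (- z - - \<omega>) ^ k = (- 1) ^ k * (1 / (z - \<omega>) ^ k)" for \<omega>
  proof -
    have "(- z - - \<omega>) ^ k = (- 1) ^ k * (z - \<omega>) ^ k"
      by (simp flip: power_mult_distrib)
    thus ?thesis by (cases "even k") auto
  qed
  have "E k (- z) = (\<Sum>\<^sub>\<infinity>\<omega>\<in>\<Lambda>0. 1 / (- z - - \<omega>) ^ k)"
    unfolding E_def by (rule infsum_reindex_bij_betw[OF bij_betw_uminus_lattice, symmetric])
  also have "\<dots> = (- 1) ^ k * E k z"
    unfolding * E_def by (rule infsum_cmult_right')
  finally show ?thesis .
qed

lemma A_uminus: "A (- z) = A z"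
proof -
  have "A (- z) = (\<Sum>\<^sub>\<infinity>\<omega>\<in>\<Lambda>0. 1 / (- z - - \<omega>) ^ 2 - 1 / (- \<omega>) ^ 2)"
    unfolding A_def
    by (rule infsum_reindex_bij_betw[OF bij_betw_uminus_lattice, symmetric])
  thus ?thesis by (simp add: A_def power2_commute)
qed

lemma E_0: "E k 0 = (- 1) ^ k * eisenstein_G k \<tau>"
proof -
  have "1 / (0 - \<omega>) ^ k = (- 1) ^ k * (1 / \<omega> ^ k)" for \<omega> :: complex
    by (cases "even k") auto
  thus ?thesis
    unfolding E_def eisenstein_G_def by (simp only: infsum_cmult_right')
qed

lemma E_0_odd: "odd k \<Longrightarrow> E k 0 = 0"
  using E_uminus[of k 0] by simp

lemma A_0: "A 0 = 0"
  by (simp add: A_def)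

subsection \<open>Elliptic functions and the differential equation\<close>

lemma lattice_induct [consumes 1, case_names one tau add uminus]:
  assumes "\<omega> \<in> \<Lambda>" "P 1" "P \<tau>" "\<And>x y. P x \<Longrightarrow> P y \<Longrightarrow> P (x + y)" "\<And>x. P x \<Longrightarrow> P (- x)"
  shows "P \<omega>"
proof -
  have P0: "P 0" using assms(4)[OF assms(2) assms(5)[OF assms(2)]] by simp
  have nat: "P (of_nat n * x)" if "P x" for n x
    using that by (induction n) (auto simp: P0 algebra_simps assms(4))
  have int: "P (of_int m * x)" if "P x" for m x
    using nat[OF that] assms(5)[OF nat[OF that]] by (cases m rule: int_cases2) auto
  obtain m n :: int where "\<omega> = of_int m + of_int n * \<tau>"
    using assms(1) unfolding lattice_def by blast
  thus ?thesis using assms(4)[OF int[OF assms(2)] int[OF assms(3)]] by simp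
qed

lemma fundamental_representative:
  obtains a b :: real where "0 \<le> a" "a \<le> 1" "0 \<le> b" "b \<le> 1" "z - (of_real a + of_real b * \<tau>) \<in> \<Lambda>"
proof -
  define y where "y = Im z / Im \<tau>"
  define x where "x = Re z - y * Re \<tau>"
  have z: "z = of_real x + of_real y * \<tau>"
    using Im_pos by (simp add: complex_eq_iff x_def y_def)
  have "z - (of_real (frac x) + of_real (frac y) * \<tau>) = of_int \<lfloor>x\<rfloor> + of_int \<lfloor>y\<rfloor> * \<tau>"
    unfolding z by (simp add: frac_def algebra_simps)
  also have "\<dots> \<in> \<Lambda>" unfolding lattice_def by blast
  finally show ?thesis
    by (intro that[of "frac x" "frac y"]) (auto simp: frac_ge_0 less_imp_le[OF frac_lt_1])
qed

text \<open>The extension of \<open>F\<close> is entire and periodic, so all its values are taken on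
  the compact fundamental parallelogram. It is bounded, and Liouville's theorem applies. The
  conclusion speaks of limits because \<open>F\<close> may have wrong values at isolated
  points.\<close>

theorem elliptic_removable_imp_constant:
  assumes rem: "\<And>z. removable F z"
    and per: "\<And>z. \<forall>\<^sub>F w in at z. F (w + 1) = F w" "\<And>z. \<forall>\<^sub>F w in at z. F (w + \<tau>) = F w"
  obtains c where "\<And>z. (F \<longlongrightarrow> c) (at z)"
proof -
  \<comment> \<open>Taking limits corrects all values at once; uniqueness of limits identifies
    \<open>G\<close> with each local analytic extension.\<close>
  define G where "G z = Lim (at z) F" for z
  have G: "\<exists>g r. r > 0 \<and> g holomorphic_on ball z r \<and> (\<forall>w\<in>ball z r. (F \<longlongrightarrow> g w) (at w))" for z
  proof -
    obtain g where g: "g analytic_on {z}" "\<forall>\<^sub>F w in at z. F w = g w"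
      using rem[of z] unfolding removable_def by blast
    obtain r1 where r1: "r1 > 0" "g holomorphic_on ball z r1"
      using g(1) unfolding analytic_on_def by auto
    obtain r2 where r2: "r2 > 0" "\<And>w. w \<in> ball z r2 \<Longrightarrow> w \<noteq> z \<Longrightarrow> F w = g w"
      using g(2) unfolding eventually_at by (auto simp: dist_commute)
    define r where "r = min r1 r2"
    have "(F \<longlongrightarrow> g w) (at w)" if w: "w \<in> ball z r" for w
    proof -
      have "isCont g w"
        using r1 w by (auto simp: r_def continuous_on_eq_continuous_at dest!: holomorphic_on_imp_continuous_on)
      hence 1: "(g \<longlongrightarrow> g w) (at w)" by (simp add: isCont_def)
      have "\<forall>\<^sub>F v in at w. F v = g v"
      proof (cases "w = z")
        case True
        thus ?thesis using g(2) by simp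
      next
        case False
        have "open (ball z r - {z})" by auto
        hence "\<forall>\<^sub>F v in at w. v \<in> ball z r - {z}"
          by (rule eventually_at_in_open') (use w False in auto)
        thus ?thesis by eventually_elim (use r2 in \<open>auto simp: r_def\<close>)
      qed
      thus ?thesis using 1 by (simp add: tendsto_cong)
    qed
    moreover have "r > 0" "g holomorphic_on ball z r"
      using r1 r2 by (auto simp: r_def intro: holomorphic_on_subset)
    ultimately show ?thesis by blast
  qed
  have FG: "(F \<longlongrightarrow> G z) (at z)" for z
    using G[of z] tendsto_Lim[of "at z" F] unfolding G_def by force
  have holo: "G holomorphic_on UNIV"
    unfolding holomorphic_on_def
  proof (intro ballI)
    fix z
    obtain g r where gr: "r > 0" "g holomorphic_on ball z r" "\<forall>w\<in>ball z r. (F \<longlongrightarrow> g w) (at w)"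
      using G[of z] by blast
    have "G w = g w" if "w \<in> ball z r" for w
      using gr(3) that FG[of w] by (meson LIM_unique)
    hence "G holomorphic_on ball z r" using gr(2) holomorphic_transform by force
    hence "G field_differentiable at z"
      using gr(1) by (simp add: holomorphic_on_imp_differentiable_at)
    thus "G field_differentiable at z within UNIV" by simp
  qed
  have shift: "G (z + d) = G z" if "\<And>z. \<forall>\<^sub>F w in at z. F (w + d) = F w" for z d
  proof -
    have "((\<lambda>w. F (w + d)) \<longlongrightarrow> G (z + d)) (at z)"
      using LIM_offset[OF FG[of "z + d"], of d] by simp
    hence "(F \<longlongrightarrow> G (z + d)) (at z)" using that[of z] by (simp add: tendsto_cong)
    thus ?thesis using FG LIM_unique by blast
  qed
  have "\<forall>z. G (z + \<omega>) = G z" if "\<omega> \<in> \<Lambda>" for \<omega>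
    using that
  proof (induction rule: lattice_induct)
    case (add x y)
    thus ?case by (metis add.assoc)
  next
    case (uminus x)
    thus ?case by (metis diff_add_cancel uminus_add_conv_diff add.commute)
  qed (use shift per in blast)+
  note per_G = this
  define h where "h = (\<lambda>(a, b). G (of_real a + of_real b * \<tau>))"
  have "compact (h ` ({0..1} \<times> {0..1}))"
    unfolding h_def case_prod_unfold
    by (intro compact_continuous_image continuous_on_compose2[OF holomorphic_on_imp_continuous_on[OF holo]]
          continuous_intros compact_Times) auto
  moreover have "range G \<subseteq> h ` ({0..1} \<times> {0..1})"
  proof clarify
    fix z
    obtain a b :: real where ab: "0 \<le> a" "a \<le> 1" "0 \<le> b" "b \<le> 1" "z - (of_real a + of_real b * \<tau>) \<in> \<Lambda>"
      by (rule fundamental_representative)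
    have "G z = h (a, b)" using per_G[OF ab(5)] unfolding h_def
      by (metis add.commute case_prod_conv diff_add_cancel)
    thus "G z \<in> h ` ({0..1} \<times> {0..1})" using ab by auto
  qed
  ultimately have "bounded (range G)" using bounded_subset compact_imp_bounded by blast
  with holo have "G constant_on UNIV" by (rule Liouville_theorem)
  then obtain c where "\<And>z. G z = c" by (auto simp: constant_on_def)
  thus ?thesis using that FG by metis
qed

text \<open>The form in which Liouville's theorem is used: the constant is read off at a convenient
  point \<open>a\<close>, mostly the origin, from the cancelled local expression
  \<open>h\<close>.\<close>

lemma elliptic_value:
  assumes rem: "\<And>z. removable F z"
    and per: "\<And>z. \<forall>\<^sub>F w in at z. F (w + 1) = F w" "\<And>z. \<forall>\<^sub>F w in at z. F (w + \<tau>) = F w"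
    and h: "h analytic_on {a}" "\<forall>\<^sub>F w in at a. F w = h w"
    and F: "F analytic_on {z}"
  shows "F z = h a"
proof -
  obtain c where c: "\<And>z. (F \<longlongrightarrow> c) (at z)"
    using elliptic_removable_imp_constant[OF rem per] by blast
  have "(F \<longlongrightarrow> h a) (at a)"
    using tendsto_cong[OF h(2)] analytic_at_imp_isCont[OF h(1)] by (simp add: isCont_def)
  hence "c = h a" using c LIM_unique by blast
  moreover have "(F \<longlongrightarrow> F z) (at z)"
    using analytic_at_imp_isCont[OF F] by (simp add: isCont_def)
  hence "F z = c" using c LIM_unique by blast
  ultimately show ?thesis by simp
qed

section \<open>The Weierstrass function, its derivatives and its periods\<close>

abbreviation wp :: "complex \<Rightarrow> complex" where "wp \<equiv> weierstrass_p \<tau>"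

text \<open>Given by the differentiated series instead of \<open>deriv\<close>, because periodicity
  of these series is a mere reindexing; that they are the derivatives off the lattice is proved
  below.\<close>

definition wp' :: "complex \<Rightarrow> complex" where "wp' z = - 2 * (1 / z ^ 3 + E 3 z)"

definition wp'' :: "complex \<Rightarrow> complex" where "wp'' z = 6 * (1 / z ^ 4 + E 4 z)"

lemma open_compl_lattice: "open (- \<Lambda>)" and open_compl_lattice0: "open (- \<Lambda>0)"
  using closed_lattice_subset by blast+

lemma wp_has_field_derivative: "z \<notin> \<Lambda> \<Longrightarrow> (wp has_field_derivative wp' z) (at z)"
proof -
  assume z: "z \<notin> \<Lambda>"
  hence "z \<noteq> 0" by auto
  have eq: "wp = (\<lambda>w. 1 / (w - 0) ^ 2 + A w)" by (rule ext) (simp add: weierstrass_p_eq)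
  show ?thesis
    unfolding eq
    using DERIV_add[OF inverse_power_has_field_derivative[OF \<open>z \<noteq> 0\<close>, of 2] A_deriv] z
    by (simp add: wp'_def eval_nat_numeral)
qed

lemma wp'_has_field_derivative: "z \<notin> \<Lambda> \<Longrightarrow> (wp' has_field_derivative wp'' z) (at z)"
proof -
  assume z: "z \<notin> \<Lambda>"
  hence "z \<noteq> 0" by auto
  have eq: "wp' = (\<lambda>w. - 2 * (1 / (w - 0) ^ 3 + E 3 w))" by (rule ext) (simp add: wp'_def)
  show ?thesis
    unfolding eq
    using DERIV_cmult[OF DERIV_add[OF inverse_power_has_field_derivative[OF \<open>z \<noteq> 0\<close>, of 3] E_deriv], of 3 "-2"] z
    by (simp add: wp''_def eval_nat_numeral algebra_simps)
qed

lemma analytic_onI_has_field_derivative: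
  fixes f :: "complex \<Rightarrow> complex"
  assumes "open S" "\<And>z. z \<in> S \<Longrightarrow> (f has_field_derivative f' z) (at z)" "z \<in> S"
  shows "f analytic_on {z}"
proof -
  have "f holomorphic_on S"
    using assms(2) unfolding holomorphic_on_def
    by (meson field_differentiable_def has_field_derivative_at_within)
  thus ?thesis using assms(1,3) analytic_at by blast
qed

lemma A_analytic: "z \<notin> \<Lambda>0 \<Longrightarrow> A analytic_on {z}"
  by (rule analytic_onI_has_field_derivative[OF open_compl_lattice0]) (auto intro!: A_deriv)

lemma E_analytic: "z \<notin> \<Lambda>0 \<Longrightarrow> k \<ge> 3 \<Longrightarrow> E k analytic_on {z}"
  by (rule analytic_onI_has_field_derivative[OF open_compl_lattice0]) (auto intro!: E_deriv)

lemma wp_analytic: "z \<notin> \<Lambda> \<Longrightarrow> wp analytic_on {z}"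
  by (rule analytic_onI_has_field_derivative[OF open_compl_lattice]) (auto intro!: wp_has_field_derivative)

lemma wp'_analytic: "z \<notin> \<Lambda> \<Longrightarrow> wp' analytic_on {z}"
  by (rule analytic_onI_has_field_derivative[OF open_compl_lattice]) (auto intro!: wp'_has_field_derivative)

lemma wp''_analytic: "z \<notin> \<Lambda> \<Longrightarrow> wp'' analytic_on {z}"
proof -
  assume "z \<notin> \<Lambda>"
  hence "z \<noteq> 0" "z \<notin> \<Lambda>0" by auto
  thus ?thesis unfolding wp''_def[abs_def] by (auto intro!: analytic_intros E_analytic)
qed

lemma wp_uminus [simp]: "wp (- z) = wp z"
  by (simp add: weierstrass_p_eq A_uminus)

lemma wp'_uminus [simp]: "wp' (- z) = - wp' z"
  by (simp add: wp'_def E_uminus)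

lemma lattice_sum_periodic:
  assumes "z \<notin> \<Lambda>" "\<omega> \<in> \<Lambda>" "k \<ge> 3"
  shows "1 / (z + \<omega>) ^ k + E k (z + \<omega>) = 1 / z ^ k + E k z"
proof -
  have eq: "1 / z ^ k + E k z = (\<Sum>\<^sub>\<infinity>\<eta>\<in>\<Lambda>. 1 / (z - \<eta>) ^ k)" if "z \<notin> \<Lambda>" for z
  proof -
    have "(\<Sum>\<^sub>\<infinity>\<eta>\<in>insert 0 \<Lambda>0. 1 / (z - \<eta>) ^ k) = 1 / (z - 0) ^ k + (\<Sum>\<^sub>\<infinity>\<eta>\<in>\<Lambda>0. 1 / (z - \<eta>) ^ k)"
      using that assms(3) by (intro infsum_insert summable_E) auto
    moreover have "insert 0 \<Lambda>0 = \<Lambda>" by (simp add: insert_absorb)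
    ultimately show ?thesis by (simp add: E_def)
  qed
  have "bij_betw (\<lambda>\<eta>. \<eta> + \<omega>) \<Lambda> \<Lambda>"
    by (rule bij_betwI[of _ _ _ "\<lambda>\<eta>. \<eta> - \<omega>"]) (use assms in auto)
  from infsum_reindex_bij_betw[OF this, of "\<lambda>\<eta>. 1 / (z + \<omega> - \<eta>) ^ k"]
  have "(\<Sum>\<^sub>\<infinity>\<eta>\<in>\<Lambda>. 1 / (z - \<eta>) ^ k) = (\<Sum>\<^sub>\<infinity>\<eta>\<in>\<Lambda>. 1 / (z + \<omega> - \<eta>) ^ k)"
    by simp
  thus ?thesis using eq[of z] eq[of "z + \<omega>"] assms by simp
qed

lemma wp'_periodic: "z \<notin> \<Lambda> \<Longrightarrow> \<omega> \<in> \<Lambda> \<Longrightarrow> wp' (z + \<omega>) = wp' z"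
  using lattice_sum_periodic[of z \<omega> 3] by (simp add: wp'_def)

lemma wp''_periodic: "z \<notin> \<Lambda> \<Longrightarrow> \<omega> \<in> \<Lambda> \<Longrightarrow> wp'' (z + \<omega>) = wp'' z"
  using lattice_sum_periodic[of z \<omega> 4] by (simp add: wp''_def)

lemma connected_compl_lattice: "connected (- \<Lambda>)"
  by (intro path_connected_imp_connected path_connected_complement_countable countable_lattice) simp

lemma zero_deriv_imp_constant:
  assumes "\<And>z. z \<notin> \<Lambda> \<Longrightarrow> (f has_field_derivative 0) (at z)"
  obtains c where "\<And>z. z \<notin> \<Lambda> \<Longrightarrow> f z = c"
proof -
  have "continuous_on (-\<Lambda>) f"
    using assms by (intro continuous_at_imp_continuous_on ballI DERIV_isCont) auto
  from DERIV_zero_connected_constant[OF connected_compl_lattice open_compl_lattice _ this, of "{}"]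
  obtain c where "\<And>z. z \<in> -\<Lambda> \<Longrightarrow> f z = c" using assms by auto
  thus ?thesis using that by auto
qed

lemma half_period_notin_lattice: "1 / 2 \<notin> \<Lambda>" "\<tau> / 2 \<notin> \<Lambda>"
proof -
  have *: False if "of_int a + of_int b * \<tau> = 2 * (of_int m + of_int n * \<tau>)" "odd a \<or> odd b" for a b m n :: int
  proof -
    have "(\<lambda>(m, n). of_int m + of_int n * \<tau>) (a, b) = (\<lambda>(m, n). of_int m + of_int n * \<tau>) (2 * m, 2 * n)"
      using that(1) by (simp add: algebra_simps)
    hence "(a, b) = (2 * m, 2 * n)"
      using bij_betw_lattice unfolding bij_betw_def by (blast dest: injD)
    thus False using that(2) by auto
  qed
  show "1 / 2 \<notin> \<Lambda>"
  proof
    assume "1 / 2 \<in> \<Lambda>"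
    then obtain m n :: int where "1 / 2 = of_int m + of_int n * \<tau>" unfolding lattice_def by blast
    thus False using *[of 1 0 m n] by (simp add: field_simps)
  qed
  show "\<tau> / 2 \<notin> \<Lambda>"
  proof
    assume "\<tau> / 2 \<in> \<Lambda>"
    then obtain m n :: int where "\<tau> / 2 = of_int m + of_int n * \<tau>" unfolding lattice_def by blast
    thus False using *[of 0 1 m n] by (simp add: field_simps)
  qed
qed

text \<open>Reindexing fails here, since the series for \<open>wp\<close> converges only thanks to
  its correction terms. But \<open>wp'\<close> is periodic, so wp(z + \<omega>) - wp(z) is constant,
  and at z = -\<omega>/2 it vanishes because \<open>wp\<close> is even. This needs \<omega>/2 off
  the lattice, which holds for the generators 1 and \<tau>; induction does the rest.\<close>

lemma wp_periodic:
  assumes "z \<notin> \<Lambda>" "\<omega> \<in> \<Lambda>"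
  shows "wp (z + \<omega>) = wp z"
proof -
  have *: "\<forall>z. z \<notin> \<Lambda> \<longrightarrow> wp (z + \<omega>) = wp z" if \<omega>: "\<omega> \<in> \<Lambda>" "\<omega> / 2 \<notin> \<Lambda>" for \<omega>
  proof -
    have "((\<lambda>w. wp (w + \<omega>) - wp w) has_field_derivative 0) (at z)" if "z \<notin> \<Lambda>" for z
    proof -
      have "((\<lambda>w. wp (w + \<omega>) - wp w) has_field_derivative wp' (z + \<omega>) - wp' z) (at z)"
        using wp_has_field_derivative[of "z + \<omega>"] wp_has_field_derivative[OF that] that \<omega>
        by (intro DERIV_diff) (auto simp: DERIV_shift)
      thus ?thesis using that \<omega> wp'_periodic by simp
    qed
    then obtain c where c: "\<And>z. z \<notin> \<Lambda> \<Longrightarrow> wp (z + \<omega>) - wp z = c"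
      using zero_deriv_imp_constant by blast
    have "c = 0" using c[of "- (\<omega> / 2)"] \<omega> by simp
    thus ?thesis using c by auto
  qed
  \<comment> \<open>Membership is carried along because the negation case must know that z - x stays
    off the lattice.\<close>
  have "\<omega> \<in> \<Lambda> \<and> (\<forall>z. z \<notin> \<Lambda> \<longrightarrow> wp (z + \<omega>) = wp z)"
    using assms(2)
  proof (induction rule: lattice_induct)
    case (add x y)
    thus ?case by (auto simp: lattice_add simp flip: add.assoc)
  next
    case (uminus x)
    hence "wp (z - x + x) = wp (z - x)" if "z \<notin> \<Lambda>" for z
      using that by (metis lattice_diff_iff)
    with uminus show ?case by auto
  qed (use * half_period_notin_lattice in auto)
  thus ?thesis using assms(1) by blast
qed

section \<open>Laurent coefficients and the differential equation\<close>

abbreviation G4 where "G4 \<equiv> eisenstein_G 4 \<tau>"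
abbreviation G6 where "G6 \<equiv> eisenstein_G 6 \<tau>"

lemma eventually_notin_lattice0: "z \<notin> \<Lambda>0 \<Longrightarrow> \<forall>\<^sub>F w in nhds z. w \<notin> \<Lambda>0"
  by (rule eventually_mono[OF eventually_nhds_in_open[OF open_compl_lattice0]]) auto

lemma higher_deriv_E:
  assumes "z \<notin> \<Lambda>0" "k \<ge> 3"
  shows "(deriv ^^ j) (E k) z = (- 1) ^ j * pochhammer (of_nat k) j * E (k + j) z"
  using assms(1)
proof (induction j arbitrary: z)
  case (Suc j)
  have "\<forall>\<^sub>F w in nhds z. (deriv ^^ j) (E k) w = (- 1) ^ j * pochhammer (of_nat k) j * E (k + j) w"
    using eventually_notin_lattice0[OF Suc.prems] by eventually_elim (rule Suc.IH)
  hence "(deriv ^^ Suc j) (E k) z = deriv (\<lambda>w. (- 1) ^ j * pochhammer (of_nat k) j * E (k + j) w) z"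
    by (simp add: deriv_cong_ev)
  also have "\<dots> = (- 1) ^ j * pochhammer (of_nat k) j * (- of_nat (k + j) * E (Suc (k + j)) z)"
    by (intro DERIV_imp_deriv DERIV_cmult E_deriv) (use assms Suc.prems in auto)
  finally show ?case by (simp add: pochhammer_Suc algebra_simps)
qed auto

lemma higher_deriv_A:
  assumes "z \<notin> \<Lambda>0"
  shows "(deriv ^^ Suc j) A z = (- 1) ^ Suc j * fact (j + 2) * E (j + 3) z"
  using assms
proof (induction j arbitrary: z)
  case 0
  thus ?case using DERIV_imp_deriv[OF A_deriv[OF 0]] by (simp add: fact_numeral)
next
  case (Suc j)
  have "\<forall>\<^sub>F w in nhds z. (deriv ^^ Suc j) A w = (- 1) ^ Suc j * fact (j + 2) * E (j + 3) w"
    using eventually_notin_lattice0[OF Suc.prems] by eventually_elim (rule Suc.IH)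
  hence "(deriv ^^ Suc (Suc j)) A z = deriv (\<lambda>w. (- 1) ^ Suc j * fact (j + 2) * E (j + 3) w) z"
    by (simp add: deriv_cong_ev)
  also have "\<dots> = (- 1) ^ Suc j * fact (j + 2) * (- of_nat (j + 3) * E (Suc (j + 3)) z)"
    by (intro DERIV_imp_deriv DERIV_cmult E_deriv) (use Suc.prems in auto)
  finally show ?case by (simp add: algebra_simps)
qed

text \<open>The odd coefficients vanish because \<open>E k 0 = 0\<close> for odd \<open>k\<close>.
  Order 5 is enough: the worst factor that \<open>A\<close> meets later is w^(-4), in the expansion
  of \<open>4 * wp w ^ 3\<close>.\<close>

lemma A_taylor:
  obtains g where "g analytic_on {0}"
    "\<forall>\<^sub>F w in nhds 0. A w = 3 * G4 * w ^ 2 + 5 * G6 * w ^ 4 + w ^ 5 * g w"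
proof -
  have odd: "E 3 0 = 0" "E 5 0 = 0" by (simp_all add: E_0_odd)
  have d: "(deriv ^^ 1) A 0 = 0" "(deriv ^^ 2) A 0 = 6 * G4" "(deriv ^^ 3) A 0 = 0" "(deriv ^^ 4) A 0 = 120 * G6"
    using higher_deriv_A[of 0 0] higher_deriv_A[of 0 1] higher_deriv_A[of 0 2] higher_deriv_A[of 0 3]
      odd E_0[of 4] E_0[of 6]
    by (simp_all add: numeral_eq_Suc)
  obtain g where g: "g analytic_on {0}"
    "\<forall>\<^sub>F w in nhds 0. A w = (\<Sum>k<5. (deriv ^^ k) A 0 / fact k * (w - 0) ^ k) + (w - 0) ^ 5 * g w"
    using analytic_taylor[OF A_analytic, of 0 5] by auto
  have "{..<5::nat} = {0, 1, 2, 3, 4}" by auto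
  hence "(\<Sum>k<5. (deriv ^^ k) A 0 / fact k * (w - 0) ^ k) = 3 * G4 * w ^ 2 + 5 * G6 * w ^ 4" for w
    using d by (simp add: A_0 fact_numeral)
  with g show ?thesis using that by simp
qed

lemma E3_taylor:
  obtains g where "g analytic_on {0}"
    "\<forall>\<^sub>F w in nhds 0. E 3 w = - 3 * G4 * w - 10 * G6 * w ^ 3 + w ^ 4 * g w"
proof -
  have odd: "E 3 0 = 0" "E 5 0 = 0" by (simp_all add: E_0_odd)
  have d: "(deriv ^^ 1) (E 3) 0 = - 3 * G4" "(deriv ^^ 2) (E 3) 0 = 0" "(deriv ^^ 3) (E 3) 0 = - 60 * G6"
    using higher_deriv_E[of 0 3 1] higher_deriv_E[of 0 3 2] higher_deriv_E[of 0 3 3]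
      odd E_0[of 4] E_0[of 6]
    by (simp_all add: numeral_eq_Suc pochhammer_Suc)
  obtain g where g: "g analytic_on {0}"
    "\<forall>\<^sub>F w in nhds 0. E 3 w = (\<Sum>k<4. (deriv ^^ k) (E 3) 0 / fact k * (w - 0) ^ k) + (w - 0) ^ 4 * g w"
    using analytic_taylor[OF E_analytic, of 0 3 4] by auto
  have "{..<4::nat} = {0, 1, 2, 3}" by auto
  hence "(\<Sum>k<4. (deriv ^^ k) (E 3) 0 / fact k * (w - 0) ^ k) = - 3 * G4 * w - 10 * G6 * w ^ 3" for w
    using d by (simp add: E_0_odd fact_numeral)
  with g show ?thesis using that by simp
qed

lemma eventually_periodic:
  assumes "\<And>z. z \<notin> \<Lambda> \<Longrightarrow> F (z + \<omega>) = F z"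
  shows "\<forall>\<^sub>F w in at z. F (w + \<omega>) = F w"
  using eventually_notin_lattice[of z] by eventually_elim (rule assms)

text \<open>The poles 6/w^4 cancel, and the cross term 12 A(w)/w^2 is regular because
  \<open>A\<close> vanishes to second order. The constant is the value at the origin, 6
  \<open>G4\<close> - 36 \<open>G4\<close>.\<close>

lemma wp''_eq:
  assumes "z \<notin> \<Lambda>"
  shows "wp'' z = 6 * wp z ^ 2 - 30 * G4"
proof -
  define F where "F = (\<lambda>w. wp'' w - 6 * wp w ^ 2)"
  obtain g where g: "g analytic_on {0}"
    "\<forall>\<^sub>F w in nhds 0. A w = 3 * G4 * w ^ 2 + 5 * G6 * w ^ 4 + w ^ 5 * g w"
    by (rule A_taylor)
  define h where "h = (\<lambda>w. 6 * E 4 w - 12 * (3 * G4 + 5 * G6 * w ^ 2 + w ^ 3 * g w) - 6 * A w ^ 2)"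
  have h: "h analytic_on {0}"
    unfolding h_def by (intro analytic_intros E_analytic A_analytic g) auto
  have "\<forall>\<^sub>F w in at 0. w \<noteq> (0::complex)" by (rule eventually_neq_at_within)
  moreover have "\<forall>\<^sub>F w in at 0. A w = 3 * G4 * w ^ 2 + 5 * G6 * w ^ 4 + w ^ 5 * g w"
    using g(2) by (simp add: eventually_at_filter eventually_mono)
  ultimately have Fh: "\<forall>\<^sub>F w in at 0. F w = h w"
  proof eventually_elim
    case (elim w)
    have "A w / w ^ 2 = 3 * G4 + 5 * G6 * w ^ 2 + w ^ 3 * g w"
      using elim by (simp add: field_simps eval_nat_numeral)
    moreover have "F w = 6 * E 4 w - 12 * (A w / w ^ 2) - 6 * A w ^ 2"
      using elim(1) unfolding F_def wp''_def weierstrass_p_eq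
      by (simp add: field_simps eval_nat_numeral)
    ultimately show ?case unfolding h_def by simp
  qed
  have per: "F (z + \<omega>) = F z" if "z \<notin> \<Lambda>" "\<omega> \<in> \<Lambda>" for z \<omega>
    using that by (simp add: F_def wp_periodic wp''_periodic)
  have rem0: "removable F 0" using h Fh by (rule removableI)
  have rem: "removable F z" for z
  proof (cases "z \<in> \<Lambda>")
    case True
    have "F (w + - z) = F w" if "w \<notin> \<Lambda>" for w
      using per[OF that, of "-z"] True by simp
    thus ?thesis
      using rem0 by (intro removable_shift[of F z "-z"] eventually_periodic) simp_all
  next
    case False
    thus ?thesis unfolding F_def
      by (intro analytic_imp_removable analytic_intros wp_analytic wp''_analytic) auto
  qed
  have "F analytic_on {z}" unfolding F_def
    using assms by (intro analytic_intros wp_analytic wp''_analytic) auto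
  hence "F z = h 0"
    using per by (intro elliptic_value[OF rem _ _ h Fh] eventually_periodic) auto
  also have "h 0 = - 30 * G4" by (simp add: h_def A_0 E_0)
  finally show ?thesis by (simp add: F_def algebra_simps)
qed

text \<open>By the formula for \<open>wp''\<close>, the derivative of \<open>F\<close> is zero, so
  only the constant has to be found from the expansion at the origin.\<close>

lemma wp'_power2:
  assumes "z \<notin> \<Lambda>"
  shows "wp' z ^ 2 = 4 * wp z ^ 3 - 60 * G4 * wp z - 140 * G6"
proof -
  define F where "F = (\<lambda>w. wp' w ^ 2 - 4 * wp w ^ 3 + 60 * G4 * wp w)"
  have "(F has_field_derivative 0) (at z)" if "z \<notin> \<Lambda>" for z
    unfolding F_def
    by (rule derivative_eq_intros wp_has_field_derivative[OF that] wp'_has_field_derivative[OF that] refl)+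
       (simp add: wp''_eq[OF that] algebra_simps power2_eq_square)
  then obtain c where c: "\<And>z. z \<notin> \<Lambda> \<Longrightarrow> F z = c" using zero_deriv_imp_constant by blast
  obtain g where g: "g analytic_on {0}"
    "\<forall>\<^sub>F w in nhds 0. A w = 3 * G4 * w ^ 2 + 5 * G6 * w ^ 4 + w ^ 5 * g w"
    by (rule A_taylor)
  obtain k where k: "k analytic_on {0}"
    "\<forall>\<^sub>F w in nhds 0. E 3 w = - 3 * G4 * w - 10 * G6 * w ^ 3 + w ^ 4 * k w"
    by (rule E3_taylor)
  define h where "h = (\<lambda>w. - 140 * G6 + w * (8 * k w - 12 * g w) + 4 * E 3 w ^ 2
     - 12 * w ^ 2 * (3 * G4 + 5 * G6 * w ^ 2 + w ^ 3 * g w) ^ 2 - 4 * A w ^ 3 + 60 * G4 * A w)"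
  have h: "h analytic_on {0}"
    unfolding h_def by (intro analytic_intros E_analytic A_analytic g k) auto
  have "\<forall>\<^sub>F w in at 0. w \<noteq> (0::complex)" by (rule eventually_neq_at_within)
  moreover have "\<forall>\<^sub>F w in at 0. A w = 3 * G4 * w ^ 2 + 5 * G6 * w ^ 4 + w ^ 5 * g w"
    using g(2) by (simp add: eventually_at_filter eventually_mono)
  moreover have "\<forall>\<^sub>F w in at 0. E 3 w = - 3 * G4 * w - 10 * G6 * w ^ 3 + w ^ 4 * k w"
    using k(2) by (simp add: eventually_at_filter eventually_mono)
  ultimately have "\<forall>\<^sub>F w in at 0. F w = h w"
  proof eventually_elim
    case (elim w)
    define B where "B = 3 * G4 + 5 * G6 * w ^ 2 + w ^ 3 * g w"
    have AB: "A w = w ^ 2 * B" using elim(2) by (simp add: B_def algebra_simps eval_nat_numeral)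
    have "F w = 8 * (E 3 w / w ^ 3) - 12 * (B / w ^ 2) + 60 * G4 / w ^ 2 + 4 * E 3 w ^ 2
            - 12 * w ^ 2 * B ^ 2 - 4 * A w ^ 3 + 60 * G4 * A w"
      using elim(1) unfolding F_def wp'_def weierstrass_p_eq AB
      by (simp add: field_simps eval_nat_numeral)
    \<comment> \<open>The w^(-2) terms cancel since -24 - 36 + 60 = 0, and the constant is 8 (-10) -
      12 * 5 = -140 times \<open>G6\<close>.\<close>
    moreover have "8 * (E 3 w / w ^ 3) - 12 * (B / w ^ 2) + 60 * G4 / w ^ 2 = - 140 * G6 + w * (8 * k w - 12 * g w)"
      using elim(1) unfolding elim(3) B_def by (simp add: field_simps eval_nat_numeral)
    ultimately show ?case unfolding h_def B_def by simp
  qed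
  moreover have "\<forall>\<^sub>F w in at 0. F w = c"
    using eventually_notin_lattice[of 0] by eventually_elim (rule c)
  ultimately have hc: "\<forall>\<^sub>F w in at 0. h w = c" by eventually_elim simp
  have "isCont h 0" using h analytic_at_imp_isCont by blast
  hence "(h \<longlongrightarrow> h 0) (at 0)" by (simp add: isCont_def)
  hence "((\<lambda>w. c) \<longlongrightarrow> h 0) (at (0::complex))" using tendsto_cong[OF hc, of "h 0"] by blast
  hence "c = h 0" by (simp add: tendsto_const_iff)
  also have "h 0 = - 140 * G6" by (simp add: h_def A_0 E_0_odd)
  finally show ?thesis using c[OF assms] by (simp add: F_def algebra_simps)
qed

subsection \<open>The discriminant, half periods and duplication\<close>

text \<open>Otherwise w^2 (wp(w) - c) would vanish near 0, but it tends to 1.\<close>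

lemma wp_nonconstant: "\<not> (\<forall>z. z \<notin> \<Lambda> \<longrightarrow> wp z = c)"
proof
  assume *: "\<forall>z. z \<notin> \<Lambda> \<longrightarrow> wp z = c"
  have "\<forall>\<^sub>F w in at 0. 1 + w ^ 2 * (A w - c) = 0"
    using eventually_notin_lattice[of 0]
  proof eventually_elim
    case (elim w)
    hence "w \<noteq> 0" "1 / w ^ 2 + A w = c" using * by (auto simp: weierstrass_p_eq)
    thus ?case by (simp add: field_simps)
  qed
  hence "((\<lambda>w. 1 + w ^ 2 * (A w - c)) \<longlongrightarrow> 0) (at 0)"
    by (rule tendsto_eventually)
  moreover have "(\<lambda>w. 1 + w ^ 2 * (A w - c)) analytic_on {0}"
    by (intro analytic_intros A_analytic) auto
  from analytic_at_tendsto[OF this] have "((\<lambda>w. 1 + w ^ 2 * (A w - c)) \<longlongrightarrow> 1) (at 0)"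
    by simp
  ultimately show False using LIM_unique zero_neq_one by blast
qed

text \<open>The hypotheses say that the cubic is 4 (x - e)^2 (x + 2 e). If \<open>wp - e\<close> had
  a zero of order n at \<open>z\<close>, then \<open>wp' ^ 2\<close> would vanish there to order
  exactly 2 n - 2, but the cubic to order at least 2 n.\<close>

lemma wp_neq_double_root:
  assumes e: "60 * G4 = 12 * e ^ 2" "140 * G6 = - 8 * e ^ 3" and z: "z \<notin> \<Lambda>"
  shows "wp z \<noteq> e"
proof
  assume "wp z = e"
  have holo: "(\<lambda>w. wp w - e) holomorphic_on - \<Lambda>"
    by (intro holomorphic_intros analytic_imp_holomorphic)
       (use wp_analytic analytic_on_analytic_at in blast)
  have nc: "\<not> (\<lambda>w. wp w - e) constant_on - \<Lambda>"
  proof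
    assume "(\<lambda>w. wp w - e) constant_on - \<Lambda>"
    then obtain c where c: "\<And>w. w \<in> - \<Lambda> \<Longrightarrow> wp w - e = c" unfolding constant_on_def by blast
    have "wp w = c + e" if "w \<notin> \<Lambda>" for w using c[of w] that by (simp add: algebra_simps)
    thus False using wp_nonconstant by blast
  qed
  have root: "wp z - e = 0" using \<open>wp z = e\<close> by simp
  have mem: "z \<in> - \<Lambda>" using z by simp
  show False
  proof (rule holomorphic_factor_zero_nonconstant[OF holo open_compl_lattice connected_compl_lattice
        mem root nc])
    fix g r n
    assume g: "0 < n" "0 < r" "ball z r \<subseteq> - \<Lambda>" "g holomorphic_on ball z r"
      "\<And>w. w \<in> ball z r \<Longrightarrow> wp w - e = (w - z) ^ n * g w" "\<And>w. w \<in> ball z r \<Longrightarrow> g w \<noteq> 0"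
    obtain m where n: "n = Suc m" using g(1) by (cases n) auto
    \<comment> \<open>What remains of \<open>wp' ^ 2\<close> minus the cubic after dividing by (w -
      z)^(2 n - 2); its value at \<open>z\<close> is (n g(z))^2, which is not 0.\<close>
    define h where "h = (\<lambda>w. (of_nat n * g w + (w - z) * deriv g w) ^ 2 - (w - z) ^ 2 * (4 * g w ^ 2 * (wp w + 2 * e)))"
    have "\<forall>\<^sub>F w in at z. w \<in> ball z r - {z}"
      using eventually_at_in_open[of "ball z r" z] g(2) by simp
    hence "\<forall>\<^sub>F w in at z. h w = 0"
    proof eventually_elim
      case (elim w)
      hence w: "w \<in> ball z r" "w \<noteq> z" "w \<notin> \<Lambda>" using g(3) by auto
      have "(g has_field_derivative deriv g w) (at w)"
        by (rule holomorphic_derivI[OF g(4) open_ball w(1)])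
      hence "((\<lambda>w. (w - z) ^ n * g w) has_field_derivative
          (1 + of_nat m) * (1 * (w - z) ^ m) * g w + deriv g w * (w - z) ^ n) (at w)"
        unfolding n by (intro DERIV_mult DERIV_power_Suc) (auto intro!: derivative_eq_intros)
      moreover have "((\<lambda>w. wp w - e) has_field_derivative wp' w) (at w)"
        using wp_has_field_derivative[OF w(3)] by (auto intro!: derivative_eq_intros)
      hence "((\<lambda>w. (w - z) ^ n * g w) has_field_derivative wp' w) (at w)"
        by (rule has_field_derivative_transform_within_open[of _ _ _ "ball z r"]) (use w g(5) in auto)
      ultimately have "wp' w = (1 + of_nat m) * (1 * (w - z) ^ m) * g w + deriv g w * (w - z) ^ n"
        by (metis DERIV_unique)
      hence 1: "wp' w = (w - z) ^ m * (of_nat n * g w + (w - z) * deriv g w)"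
        by (simp add: n algebra_simps)
      have "wp' w ^ 2 = 4 * wp w ^ 3 - 12 * e ^ 2 * wp w + 8 * e ^ 3"
        unfolding wp'_power2[OF w(3)] e by simp
      also have "\<dots> = 4 * (wp w - e) ^ 2 * (wp w + 2 * e)"
        by (simp add: algebra_simps power2_eq_square power3_eq_cube)
      also have "\<dots> = ((w - z) ^ m) ^ 2 * ((w - z) ^ 2 * (4 * g w ^ 2 * (wp w + 2 * e)))"
        by (simp add: g(5)[OF w(1)] n power_mult_distrib)
      finally have "((w - z) ^ m) ^ 2 * h w = 0"
        unfolding 1 h_def power_mult_distrib by (simp add: right_diff_distrib)
      thus ?case using w(2) by simp
    qed
    hence "(h \<longlongrightarrow> 0) (at z)" by (rule tendsto_eventually)
    moreover have "h analytic_on {z}"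
    proof -
      have "g analytic_on {z}" using g(2,4) unfolding analytic_on_def by auto
      thus ?thesis unfolding h_def using z by (intro analytic_intros wp_analytic) auto
    qed
    hence "(h \<longlongrightarrow> h z) (at z)" by (rule analytic_at_tendsto)
    ultimately have "h z = 0" using LIM_unique by blast
    thus False using g(1,2) g(6)[of z] by (simp add: h_def)
  qed
qed

text \<open>Up to the factor 10800 this is g2^3 - 27 g3^2 with g2 = 60 \<open>G4\<close> and g3 =
  140 \<open>G6\<close>.\<close>

theorem discriminant_nonzero: "20 * G4 ^ 3 - 49 * G6 ^ 2 \<noteq> 0"
proof
  assume D: "20 * G4 ^ 3 - 49 * G6 ^ 2 = 0"
  obtain e where e: "60 * G4 = 12 * e ^ 2" "140 * G6 = - 8 * e ^ 3"
  proof (cases "G4 = 0")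
    case True
    thus ?thesis using D that[of 0] by simp
  next
    case False
    show ?thesis
    \<comment> \<open>Solving for the double root: e^2 = 5 \<open>G4\<close> turns 140
      \<open>G6\<close> = -8 e^3 into 140 \<open>G6\<close> = -40 \<open>G4\<close> e.\<close>
    proof (rule that[of "- 7 * G6 / (2 * G4)"])
      have *: "49 * G6 ^ 2 = 20 * G4 ^ 3" using D by simp
      have "12 * (- 7 * G6 / (2 * G4)) ^ 2 = 3 * (49 * G6 ^ 2) / G4 ^ 2"
        by (simp add: power_divide power_mult_distrib)
      also have "\<dots> = 60 * G4"
        unfolding * using False by (simp add: power2_eq_square power3_eq_cube)
      finally show "60 * G4 = 12 * (- 7 * G6 / (2 * G4)) ^ 2" ..
      have "- 8 * (- 7 * G6 / (2 * G4)) ^ 3 = 7 * (49 * G6 ^ 2) * G6 / G4 ^ 3"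
        by (simp add: power_divide power_mult_distrib eval_nat_numeral)
      also have "\<dots> = 140 * G6" unfolding * using False by simp
      finally show "140 * G6 = - 8 * (- 7 * G6 / (2 * G4)) ^ 3" ..
    qed
  qed
  define F where "F = (\<lambda>w. 1 / (wp w - e))"
  define h where "h = (\<lambda>w. w ^ 2 / (1 + w ^ 2 * (A w - e)))"
  have h: "h analytic_on {0}"
    unfolding h_def by (intro analytic_intros A_analytic) auto
  have "\<forall>\<^sub>F w in at 0. w \<noteq> (0::complex)" by (rule eventually_neq_at_within)
  hence Fh: "\<forall>\<^sub>F w in at 0. F w = h w"
  proof eventually_elim
    case (elim w)
    have "h w = w ^ 2 / (w ^ 2 * (wp w - e))"
      using elim by (simp add: h_def weierstrass_p_eq algebra_simps)
    thus ?case using elim by (simp add: F_def)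
  qed
  have an: "F analytic_on {z}" if "z \<notin> \<Lambda>" for z
    unfolding F_def using that wp_neq_double_root[OF e that] by (intro analytic_intros wp_analytic) auto
  have rem: "removable F z" for z
  proof (cases "z \<in> \<Lambda>")
    case True
    have "F (w + - z) = F w" if "w \<notin> \<Lambda>" for w
      using wp_periodic[OF that, of "-z"] True by (simp add: F_def)
    thus ?thesis
      using removableI[OF h Fh] by (intro removable_shift[of F z "-z"] eventually_periodic) simp_all
  next
    case False
    thus ?thesis by (rule analytic_imp_removable[OF an])
  qed
  \<comment> \<open>At the origin 1/(wp - e) extends by the value 0, so the constant function would
    be 0, which no reciprocal of a nonzero number is.\<close>
  have "F (1 / 2) = h 0"
    by (intro elliptic_value[OF rem _ _ h Fh an] eventually_periodic half_period_notin_lattice)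
       (simp_all add: F_def wp_periodic)
  thus False
    using wp_neq_double_root[OF e half_period_notin_lattice(1)] by (simp add: F_def h_def)
qed

text \<open>Otherwise \<open>wp z\<close> is a common root of the cubic and its derivative;
  eliminating it makes the discriminant vanish.\<close>

lemma wp'_zero_imp_wp''_nonzero:
  assumes "z \<notin> \<Lambda>" "wp' z = 0"
  shows "wp'' z \<noteq> 0"
proof
  assume "wp'' z = 0"
  hence 1: "wp z ^ 2 = 5 * G4" using wp''_eq[OF assms(1)] by simp
  have "4 * wp z * wp z ^ 2 - 60 * G4 * wp z - 140 * G6 = 0"
    using wp'_power2[OF assms(1)] assms(2) by (simp add: power2_eq_square power3_eq_cube mult.assoc)
  hence "7 * G6 = - 2 * G4 * wp z" unfolding 1 by (simp add: algebra_simps)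
  hence "(7 * G6) ^ 2 = 4 * G4 ^ 2 * wp z ^ 2" by (simp add: power_mult_distrib)
  hence "49 * G6 ^ 2 = 20 * G4 ^ 3" unfolding 1 by (simp add: power_mult_distrib eval_nat_numeral)
  thus False using discriminant_nonzero by simp
qed

lemma wp_taylor:
  assumes "z \<notin> \<Lambda>" "wp' z = 0"
  obtains g where "g analytic_on {z}" "g z = wp'' z / 2"
    "\<forall>\<^sub>F w in nhds z. wp w = wp z + (w - z) ^ 2 * g w"
proof -
  obtain g where g: "g analytic_on {z}" "g z = (deriv ^^ 2) wp z / fact 2"
    "\<forall>\<^sub>F w in nhds z. wp w = (\<Sum>k<2. (deriv ^^ k) wp z / fact k * (w - z) ^ k) + (w - z) ^ 2 * g w"
    using analytic_taylor[OF wp_analytic[OF assms(1)], of 2] by auto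
  have ev: "\<forall>\<^sub>F w in nhds z. w \<notin> \<Lambda>"
    using eventually_nhds_in_open[OF open_compl_lattice, of z] assms(1) by simp
  have d1: "deriv wp w = wp' w" if "w \<notin> \<Lambda>" for w
    using wp_has_field_derivative[OF that] by (rule DERIV_imp_deriv)
  have "(deriv ^^ 2) wp z = deriv (deriv wp) z" by (simp add: eval_nat_numeral)
  also have "\<dots> = deriv wp' z"
    by (rule deriv_cong_ev) (use ev d1 in \<open>auto elim: eventually_mono\<close>)
  also have "\<dots> = wp'' z" using wp'_has_field_derivative[OF assms(1)] by (rule DERIV_imp_deriv)
  finally have "(deriv ^^ 2) wp z = wp'' z" .
  thus ?thesis using that[of g] g d1[OF assms(1)] assms(2) by (simp add: eval_nat_numeral)
qed

lemma eventually_shift_notin_lattice: "\<forall>\<^sub>F w in at z. w - d \<notin> \<Lambda>"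
  using eventually_notin_lattice[of "z - d"] eventually_at_shift[of "\<lambda>w. w \<notin> \<Lambda>" z "-d"] by simp

text \<open>This replaces a count of zeros. In the product \<open>F\<close>, each factor has a
  double pole where the other has a double zero: at \<open>z0\<close>, and at 0 because
  \<open>wp\<close> is even. So \<open>F\<close> is constant, with value wp''(z0)/2 at
  \<open>z0\<close>, which is not 0. If 2 \<open>z0\<close> were off the lattice, \<open>F\<close>
  would be analytic at -\<open>z0\<close>, where its first factor vanishes.\<close>

lemma wp'_zero_imp_half_period:
  assumes z0: "z0 \<notin> \<Lambda>" "wp' z0 = 0"
  shows "2 * z0 \<in> \<Lambda>"
proof (rule ccontr)
  assume not: "2 * z0 \<notin> \<Lambda>"
  define e where "e = wp z0"
  define F where "F = (\<lambda>w. (wp w - e) * (wp (w - z0) - e))"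
  have neq: "\<forall>\<^sub>F w in at z. w \<noteq> z" for z :: complex by (rule eventually_neq_at_within)
  obtain g where g: "g analytic_on {z0}" "g z0 = wp'' z0 / 2"
    "\<forall>\<^sub>F w in nhds z0. wp w = wp z0 + (w - z0) ^ 2 * g w"
    using z0 by (rule wp_taylor)
  define h where "h = (\<lambda>w. g w * (1 + (w - z0) ^ 2 * (A (w - z0) - e)))"
  have h: "h analytic_on {z0}"
    unfolding h_def by (intro analytic_intros analytic_at_shift[of A] A_analytic g) auto
  have "\<forall>\<^sub>F w in at z0. wp w = wp z0 + (w - z0) ^ 2 * g w"
    using g(3) by (simp add: eventually_at_filter eventually_mono)
  hence Fh: "\<forall>\<^sub>F w in at z0. F w = h w"
    using neq
  proof eventually_elim
    case (elim w)
    have "F w = g w * ((w - z0) ^ 2 * (1 / (w - z0) ^ 2 + A (w - z0) - e))"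
      unfolding F_def elim(1) weierstrass_p_eq[of "w - z0"] e_def by simp
    also have "(w - z0) ^ 2 * (1 / (w - z0) ^ 2 + A (w - z0) - e) = 1 + (w - z0) ^ 2 * (A (w - z0) - e)"
      using elim(2) by (simp add: distrib_left right_diff_distrib)
    finally show ?case by (simp add: h_def)
  qed
  obtain g1 where g1: "g1 analytic_on {- z0}"
    "\<forall>\<^sub>F w in nhds (- z0). wp w = wp (- z0) + (w - - z0) ^ 2 * g1 w"
    using wp_taylor[of "- z0"] z0 by auto
  define h1 where "h1 = (\<lambda>w. (1 + w ^ 2 * (A w - e)) * g1 (w - z0))"
  have h1: "h1 analytic_on {0}"
    unfolding h1_def
    by (intro analytic_intros analytic_at_shift[of g1] A_analytic) (use g1 in auto)
  have "\<forall>\<^sub>F w in at (0 + - z0). wp w = wp (- z0) + (w - - z0) ^ 2 * g1 w"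
    using g1(2) by (simp add: eventually_at_filter eventually_mono)
  hence "\<forall>\<^sub>F w in at 0. wp (w - z0) = e + w ^ 2 * g1 (w - z0)"
    unfolding eventually_at_shift by (simp add: e_def)
  hence Fh1: "\<forall>\<^sub>F w in at 0. F w = h1 w"
    using neq
  proof eventually_elim
    case (elim w)
    have "F w = (w ^ 2 * (1 / w ^ 2 + A w - e)) * g1 (w - z0)"
      unfolding F_def elim(1) weierstrass_p_eq[of w] by simp
    also have "w ^ 2 * (1 / w ^ 2 + A w - e) = 1 + w ^ 2 * (A w - e)"
      using elim(2) by (simp add: distrib_left right_diff_distrib)
    finally show ?case by (simp add: h1_def)
  qed
  have per: "\<forall>\<^sub>F w in at z. F (w + \<omega>) = F w" if "\<omega> \<in> \<Lambda>" for z \<omega>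
    using eventually_notin_lattice[of z] eventually_shift_notin_lattice[of z0 z]
  proof eventually_elim
    case (elim w)
    thus ?case
      using wp_periodic[of w \<omega>] wp_periodic[of "w - z0" \<omega>] that
      by (simp add: F_def add_diff_eq diff_add_eq)
  qed
  have an: "F analytic_on {z}" if "z \<notin> \<Lambda>" "z - z0 \<notin> \<Lambda>" for z
    unfolding F_def using that
    by (intro analytic_intros wp_analytic analytic_at_shift[of wp]) auto
  have rem: "removable F z" for z
  proof -
    consider "z \<in> \<Lambda>" | "z - z0 \<in> \<Lambda>" | "z \<notin> \<Lambda>" "z - z0 \<notin> \<Lambda>" by blast
    thus ?thesis
    proof cases
      case 1
      thus ?thesis using removableI[OF h1 Fh1] by (intro removable_shift[of F z "-z"] per) simp_all
    next
      case 2
      hence "z0 - z \<in> \<Lambda>" using lattice_uminus[of "z - z0"] by simp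
      thus ?thesis using removableI[OF h Fh] by (intro removable_shift[of F z "z0 - z"] per) simp_all
    next
      case 3
      thus ?thesis by (rule analytic_imp_removable[OF an])
    qed
  qed
  have "- z0 - z0 \<notin> \<Lambda>" using not lattice_uminus[of "- z0 - z0"] by auto
  hence "F analytic_on {- z0}" using z0 by (intro an) auto
  hence "F (- z0) = h z0" by (intro elliptic_value[OF rem _ _ h Fh] per) auto
  hence "wp'' z0 = 0" by (simp add: F_def e_def h_def A_0 g(2))
  thus False using wp'_zero_imp_wp''_nonzero[OF z0] by simp
qed

lemma double_in_lattice: "z \<in> \<Lambda> \<Longrightarrow> 2 * z \<in> \<Lambda>"
  unfolding mult_2 by (rule lattice_add)

lemma wp'_nonzero: "2 * z \<notin> \<Lambda> \<Longrightarrow> wp' z \<noteq> 0"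
  using wp'_zero_imp_half_period[of z] double_in_lattice[of z] by blast

lemma wp''_has_field_derivative:
  assumes "z \<notin> \<Lambda>"
  shows "(wp'' has_field_derivative 12 * wp z * wp' z) (at z)"
proof -
  have "((\<lambda>w. 6 * wp w ^ 2 - 30 * G4) has_field_derivative 12 * wp z * wp' z) (at z)"
    using wp_has_field_derivative[OF assms] by (auto intro!: derivative_eq_intros)
  thus ?thesis
    by (rule has_field_derivative_transform_within_open[of _ _ _ "- \<Lambda>"])
       (use assms open_compl_lattice wp''_eq in auto)
qed

lemma eventually_double_notin_lattice: "\<forall>\<^sub>F w in at z. 2 * w \<notin> \<Lambda>"
proof -
  have "filterlim (\<lambda>w. 2 * w) (at (2 * z)) (at z)"
    unfolding filterlim_at
  proof
    show "((\<lambda>w. 2 * w) \<longlongrightarrow> 2 * z) (at z)" by (intro tendsto_intros)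
    show "\<forall>\<^sub>F w in at z. 2 * w \<in> UNIV \<and> 2 * w \<noteq> 2 * z"
      using eventually_neq_at_within[of z] by eventually_elim simp
  qed
  with eventually_notin_lattice show ?thesis by (rule eventually_compose_filterlim)
qed

lemma wp'_half_period:
  assumes "2 * z \<in> \<Lambda>" "z \<notin> \<Lambda>"
  shows "wp' z = 0"
proof -
  have "wp' z = wp' (- z + 2 * z)" by simp
  also have "\<dots> = wp' (- z)" using assms by (intro wp'_periodic) auto
  also have "\<dots> = - wp' z" by (rule wp'_uminus)
  finally have "wp' z + wp' z = 0" by (simp only: eq_neg_iff_add_eq_0)
  thus ?thesis by simp
qed

text \<open>The difference of the two sides is elliptic, and its poles must be checked at the two
  kinds of zeros of 2 z modulo the lattice: lattice points, where it tends to 0, and the other half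
  periods, where \<open>wp'\<close> has simple zeros.\<close>

theorem wp_double:
  assumes "2 * z \<notin> \<Lambda>"
  shows "wp (2 * z) = (wp'' z / (2 * wp' z)) ^ 2 - 2 * wp z"
proof -
  define F where "F = (\<lambda>w. wp (2 * w) + 2 * wp w - (wp'' w / (2 * wp' w)) ^ 2)"
  have double: "w \<notin> \<Lambda>" if "2 * w \<notin> \<Lambda>" for w
    using that double_in_lattice by blast
  have neq: "\<forall>\<^sub>F w in at z. w \<noteq> z" for z :: complex by (rule eventually_neq_at_within)
  have an: "F analytic_on {z}" if "2 * z \<notin> \<Lambda>" for z
    unfolding F_def using that double[OF that] wp'_nonzero[OF that]
    by (intro analytic_intros wp_analytic wp'_analytic wp''_analytic analytic_at_scale[of wp]) auto
  have per: "\<forall>\<^sub>F w in at z. F (w + \<omega>) = F w" if "\<omega> \<in> \<Lambda>" for z \<omega>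
    using eventually_double_notin_lattice[of z]
  proof eventually_elim
    case (elim w)
    have "wp (2 * (w + \<omega>)) = wp (2 * w)"
      using wp_periodic[OF elim, of "\<omega> + \<omega>"] that lattice_add[OF that that] by (simp add: algebra_simps)
    thus ?case
      using double[OF elim] that by (simp add: F_def wp_periodic wp'_periodic wp''_periodic)
  qed
  define h where "h = (\<lambda>w. A (2 * w) + 2 * A w + 9 / 4 * w * (E 3 w - w * E 4 w) *
     (2 + w ^ 3 * E 3 w + w ^ 4 * E 4 w) / (1 + w ^ 3 * E 3 w) ^ 2)"
  have h: "h analytic_on {0}"
    unfolding h_def by (intro analytic_intros analytic_at_scale[of A] A_analytic E_analytic) auto
  have "(\<lambda>w. 1 + w ^ 3 * E 3 w) analytic_on {0}"
    by (intro analytic_intros E_analytic) auto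
  hence "((\<lambda>w. 1 + w ^ 3 * E 3 w) \<longlongrightarrow> 1 + 0 ^ 3 * E 3 0) (at 0)"
    by (rule analytic_at_tendsto)
  hence "\<forall>\<^sub>F w in at 0. 1 + w ^ 3 * E 3 w \<noteq> 0"
    by (rule tendsto_imp_eventually_ne) auto
  hence Fh: "\<forall>\<^sub>F w in at 0. F w = h w"
    using neq
  proof eventually_elim
    case (elim w)
    define s where "s = 1 + w ^ 3 * E 3 w"
    define r where "r = 1 + w ^ 4 * E 4 w"
    have s: "s \<noteq> 0" using elim by (simp add: s_def)
    have w: "w \<noteq> 0" by fact
    have wp1: "wp' w = - 2 * s / w ^ 3" "wp'' w = 6 * r / w ^ 4"
      using w by (simp_all add: s_def r_def wp'_def wp''_def field_simps)
    have "wp'' w / (2 * wp' w) = - (3 * r) / (2 * w * s)"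
      unfolding wp1 using w s by (simp add: field_simps eval_nat_numeral)
    \<comment> \<open>The pole of wp(2 w) + 2 wp(w) is 1/(4 w^2) + 2/w^2 = 9/(4 w^2).\<close>
    hence "F w = A (2 * w) + 2 * A w + (9 / (4 * w ^ 2) - (3 * r) ^ 2 / (2 * w * s) ^ 2)"
      unfolding F_def weierstrass_p_eq by (simp add: power_divide power_mult_distrib)
    also have "9 / (4 * w ^ 2) - (3 * r) ^ 2 / (2 * w * s) ^ 2 =
        9 / 4 * ((s - r) / w ^ 2 * (s + r)) / s ^ 2"
      using w s by (simp add: divide_simps) (simp add: power2_eq_square algebra_simps)
    also have "(s - r) / w ^ 2 = w * (E 3 w - w * E 4 w)"
      using w unfolding s_def r_def by (simp add: divide_simps) (simp add: eval_nat_numeral algebra_simps)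
    finally show ?case by (simp add: h_def s_def r_def add_ac)
  qed
  have rem: "removable F z" for z
  proof -
    consider "z \<in> \<Lambda>" | "2 * z \<in> \<Lambda>" "z \<notin> \<Lambda>" | "2 * z \<notin> \<Lambda>" by blast
    thus ?thesis
    proof cases
      case 1
      thus ?thesis using removableI[OF h Fh] by (intro removable_shift[of F z "-z"] per) simp_all
    next
      case 2
      have wp'_0: "wp' z = 0" using wp'_half_period 2 by blast
      define c where "c = wp'' z"
      have c: "c \<noteq> 0" using wp'_zero_imp_wp''_nonzero 2 wp'_0 by (simp add: c_def)
      have ev: "\<forall>\<^sub>F w in nhds z. w \<notin> \<Lambda>"
        using eventually_nhds_in_open[OF open_compl_lattice, of z] 2 by simp
      have d1: "deriv wp' w = wp'' w" if "w \<notin> \<Lambda>" for w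
        using wp'_has_field_derivative[OF that] by (rule DERIV_imp_deriv)
      \<comment> \<open>The third derivative 12 \<open>wp\<close> \<open>wp'\<close> vanishes at a
        half period, so \<open>wp'\<close> has no quadratic and \<open>wp''\<close> no linear term
        there. Hence the square of wp''/(2 wp') has polar part exactly 1/(4 t^2), without a 1/t
        term, which is the polar part of wp(2 w).\<close>
      have d2: "deriv wp'' z = 0"
        using wp''_has_field_derivative[OF 2(2)] wp'_0 by (simp add: DERIV_imp_deriv)
      have "deriv (deriv wp') z = deriv wp'' z"
        by (rule deriv_cong_ev) (use ev d1 in \<open>auto elim: eventually_mono\<close>)
      hence d3: "deriv (deriv wp') z = 0" using d2 by simp
      obtain p where p: "p analytic_on {z}"
        "\<forall>\<^sub>F w in nhds z. wp' w = (\<Sum>k<3. (deriv ^^ k) wp' z / fact k * (w - z) ^ k) + (w - z) ^ 3 * p w"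
        using analytic_taylor[OF wp'_analytic[OF 2(2)], of 3] by auto
      obtain q where q: "q analytic_on {z}"
        "\<forall>\<^sub>F w in nhds z. wp'' w = (\<Sum>k<2. (deriv ^^ k) wp'' z / fact k * (w - z) ^ k) + (w - z) ^ 2 * q w"
        using analytic_taylor[OF wp''_analytic[OF 2(2)], of 2] by auto
      have p': "\<forall>\<^sub>F w in at z. wp' w = (w - z) * (c + (w - z) ^ 2 * p w)"
        using p(2) d1[OF 2(2)] d3 wp'_0
        by (simp add: eventually_at_filter eval_nat_numeral c_def algebra_simps eventually_mono)
      have q': "\<forall>\<^sub>F w in at z. wp'' w = c + (w - z) ^ 2 * q w"
        using q(2) d2
        by (simp add: eventually_at_filter eval_nat_numeral c_def algebra_simps eventually_mono)
      define k where "k = (\<lambda>w. A (2 * (w - z)) + 2 * wp w + (p w - q w) *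
        (2 * c + (w - z) ^ 2 * (p w + q w)) / (4 * (c + (w - z) ^ 2 * p w) ^ 2))"
      have k: "k analytic_on {z}"
        unfolding k_def using c 2
        by (intro analytic_intros analytic_at_shift[of "\<lambda>w. A (2 * w)"] analytic_at_scale[of A]
              A_analytic wp_analytic p q) auto
      have "(\<lambda>w. c + (w - z) ^ 2 * p w) analytic_on {z}"
        by (intro analytic_intros p)
      hence "((\<lambda>w. c + (w - z) ^ 2 * p w) \<longlongrightarrow> c + (z - z) ^ 2 * p z) (at z)"
        by (rule analytic_at_tendsto)
      hence "\<forall>\<^sub>F w in at z. c + (w - z) ^ 2 * p w \<noteq> 0"
        by (rule tendsto_imp_eventually_ne) (use c in auto)
      hence "\<forall>\<^sub>F w in at z. F w = k w"
        using p' q' neq eventually_double_notin_lattice[of z]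
      proof eventually_elim
        case (elim w)
        define t where "t = w - z"
        have t: "t \<noteq> 0" using elim by (simp add: t_def)
        define u where "u = c + t ^ 2 * p w"
        define v where "v = c + t ^ 2 * q w"
        have u: "u \<noteq> 0" using elim(1) by (simp add: u_def t_def)
        have "wp (2 * w) = wp (2 * t)"
          using wp_periodic[OF elim(5), of "- (2 * z)"] 2 by (simp add: t_def algebra_simps)
        also have "\<dots> = 1 / (4 * t ^ 2) + A (2 * t)"
          unfolding weierstrass_p_eq by (simp add: power_mult_distrib)
        finally have "F w = 1 / (4 * t ^ 2) + A (2 * t) + 2 * wp w - (v / (2 * (t * u))) ^ 2"
          unfolding F_def elim(2,3) by (simp add: u_def v_def t_def)
        also have "\<dots> = A (2 * t) + 2 * wp w + (u - v) * (u + v) / t ^ 2 / (4 * u ^ 2)"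
          using t u by (simp add: divide_simps) (simp add: power2_eq_square algebra_simps)
        also have "(u - v) * (u + v) / t ^ 2 = (p w - q w) * (2 * c + t ^ 2 * (p w + q w))"
          using t unfolding u_def v_def by (simp add: divide_simps) (simp add: algebra_simps)
        finally show ?case by (simp add: k_def t_def u_def)
      qed
      with k show ?thesis by (rule removableI)
    next
      case 3
      thus ?thesis by (rule analytic_imp_removable[OF an])
    qed
  qed
  have "F z = h 0" by (intro elliptic_value[OF rem _ _ h Fh an] per assms) auto
  thus ?thesis by (simp add: F_def h_def A_0 algebra_simps)
qed

subsection \<open>The integral over the A-cycle\<close>

abbreviation G2 where "G2 \<equiv> eisenstein_G2 \<tau>"

lemma summable_lattice_row: "(\<lambda>m::int. 1 / (of_int m + of_int n * \<tau>) ^ 2) summable_on UNIV"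
proof (rule abs_summable_summable, rule summable_on_comparison_test)
  show "(\<lambda>m::int. (2 * K) ^ 2 * (1 + \<bar>real_of_int m\<bar>) powr -2) summable_on UNIV"
    using summable_on_int_powr[of 2] by (intro summable_on_cmult_right) simp
  fix m :: int
  let ?w = "of_int m + of_int n * \<tau>"
  show "norm (1 / ?w ^ 2) \<le> (2 * K) ^ 2 * (1 + \<bar>real_of_int m\<bar>) powr -2"
  proof (cases "?w = 0")
    case False
    hence "?w \<in> \<Lambda>0" unfolding lattice_def by blast
    hence "1 \<le> K * norm ?w" by (rule norm_lattice_ge)
    hence "1 + \<bar>real_of_int m\<bar> \<le> 2 * K * norm ?w" using coeffs_le(1)[of m n] by simp
    hence "(1 + \<bar>real_of_int m\<bar>) ^ 2 \<le> (2 * K * norm ?w) ^ 2" by (intro power_mono) auto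
    hence "1 / norm ?w ^ 2 \<le> (2 * K) ^ 2 / (1 + \<bar>real_of_int m\<bar>) ^ 2"
      using False by (simp add: field_simps power_mult_distrib)
    thus ?thesis by (simp add: norm_divide norm_power powr_minus powr_numeral) (simp add: divide_inverse)
  \<comment> \<open>If the lattice point is 0, the left side is 1/0 = 0.\<close>
  qed simp
qed simp

text \<open>In the sums below, the value \<open>1 / 0 = 0\<close> makes the index \<open>\<omega> = 0\<close> contribute the
  polar term of the zeta function.\<close>

lemma zeta_quasi_period:
  assumes z: "z \<notin> \<Lambda>"
  shows "1 / z + Z z - (1 / (z + 1) + Z (z + 1)) = - G2"
proof -
  \<comment> \<open>The difference of the terms of \<open>Z\<close> at z and z + 1: the 1/\<omega>
    cancel, and the linear corrections leave -1/\<omega>^2.\<close>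
  define s where "s = (\<lambda>\<omega>. 1 / (z - \<omega>) - 1 / (z + 1 - \<omega>) - 1 / \<omega> ^ 2)"
  define r where "r = (\<lambda>n::int. \<Sum>\<^sub>\<infinity>m::int. 1 / (of_int m + of_int n * \<tau>) ^ 2)"
  have z1: "z + 1 \<notin> \<Lambda>" using z by simp
  have s_eq: "s \<omega> = (1 / (z - \<omega>) + 1 / \<omega> + z / \<omega> ^ 2) - (1 / (z + 1 - \<omega>) + 1 / \<omega> + (z + 1) / \<omega> ^ 2)" for \<omega>
    by (simp add: s_def add_divide_distrib)
  have s0: "s summable_on \<Lambda>0"
    unfolding s_eq[abs_def] by (intro summable_on_diff summable_Z) (use z z1 in auto)
  have "Z z - Z (z + 1) = infsum s \<Lambda>0"
    unfolding s_eq[abs_def] Z_def by (intro infsum_diff[symmetric] summable_Z) (use z z1 in auto)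
  moreover have "infsum s (insert 0 \<Lambda>0) = s 0 + infsum s \<Lambda>0"
    using s0 by (intro infsum_insert) auto
  moreover have "s 0 = 1 / z - 1 / (z + 1)" by (simp add: s_def)
  moreover have ins: "insert 0 \<Lambda>0 = \<Lambda>" by (simp add: insert_absorb)
  ultimately have 1: "1 / z + Z z - (1 / (z + 1) + Z (z + 1)) = infsum s \<Lambda>"
    by (simp add: algebra_simps)
  have s\<Lambda>: "s summable_on \<Lambda>"
    using summable_on_insert_iff[of s 0 \<Lambda>0] s0 ins by simp
  define f where "f = (\<lambda>(n::int, m::int). s (of_int m + of_int n * \<tau>))"
  have "bij_betw prod.swap (UNIV :: (int \<times> int) set) UNIV"
    by (rule bij_betwI[of _ _ _ prod.swap]) auto
  from bij_betw_trans[OF this bij_betw_lattice]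
  have bij: "bij_betw (\<lambda>(n, m). of_int m + of_int n * \<tau>) (UNIV \<times> UNIV) \<Lambda>"
    by (simp add: o_def case_prod_unfold)
  have f_sum: "f summable_on UNIV \<times> UNIV"
    using s\<Lambda> summable_on_reindex_bij_betw[OF bij, of s] by (simp add: f_def case_prod_unfold)
  have "infsum s \<Lambda> = infsum f (UNIV \<times> UNIV)"
    using infsum_reindex_bij_betw[OF bij, of s] by (simp add: f_def case_prod_unfold)
  \<comment> \<open>The sum over the lattice is unconditional, so it may be taken row by row, which
    is the order prescribed for \<open>G2\<close>.\<close>
  also have "\<dots> = (\<Sum>\<^sub>\<infinity>n. \<Sum>\<^sub>\<infinity>m. f (n, m))"
    using infsum_Sigma_banach[OF f_sum] by simp
  finally have 2: "infsum s \<Lambda> = (\<Sum>\<^sub>\<infinity>n. \<Sum>\<^sub>\<infinity>m. f (n, m))" .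
  have row: "(\<Sum>\<^sub>\<infinity>m. f (n, m)) = - r n" for n
  proof -
    \<comment> \<open>Within a row, z + 1 - \<omega> is z minus the preceding lattice point, so the
      first two terms of \<open>s\<close> telescope to 0 and only the squares remain.\<close>
    define h where "h = (\<lambda>m::int. 1 / (z - of_int n * \<tau> - of_int m))"
    have f_eq: "f (n, m) = (h m - h (m - 1)) - 1 / (of_int m + of_int n * \<tau>) ^ 2" for m
      by (simp add: f_def s_def h_def algebra_simps)
    have "(\<lambda>m. f (n, m)) summable_on UNIV"
      using summable_on_SigmaD1[where f = "\<lambda>n m. f (n, m)" and A = UNIV and B = "\<lambda>_. UNIV"] f_sum by simp
    from summable_on_add[OF this summable_lattice_row[of n]]
    have sm: "(\<lambda>m. h m - h (m - 1)) summable_on UNIV" by (simp add: f_eq)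
    have "(\<Sum>\<^sub>\<infinity>m. f (n, m)) = (\<Sum>\<^sub>\<infinity>m. h m - h (m - 1)) - r n"
      unfolding f_eq r_def by (intro infsum_diff sm summable_lattice_row)
    also have "(\<Sum>\<^sub>\<infinity>m. h m - h (m - 1)) = 0"
      using sm by (rule infsum_telescoping_int) (simp_all only: h_def tendsto_inverse_int)
    finally show ?thesis by simp
  qed
  have "(\<lambda>n. \<Sum>\<^sub>\<infinity>m. f (n, m)) summable_on UNIV"
    using summable_on_Sigma_banach[where f = "\<lambda>n m. f (n, m)" and A = UNIV and B = "\<lambda>_. UNIV"] f_sum by simp
  hence "(\<lambda>n. - r n) summable_on UNIV" by (simp add: row)
  hence "r summable_on UNIV" using summable_on_uminus by fastforce
  hence r_sum: "r summable_on UNIV - {0}" by (rule summable_on_subset_banach) auto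
  have "infsum r UNIV = infsum r (insert 0 (UNIV - {0}))" by (simp add: insert_UNIV)
  also have "\<dots> = r 0 + infsum r (UNIV - {0})" using r_sum by (intro infsum_insert) auto
  \<comment> \<open>In the row n = 0, the index m = 0 contributes 1/0 = 0.\<close>
  also have "r 0 = (\<Sum>\<^sub>\<infinity>m\<in>UNIV - {0 :: int}. 1 / of_int m ^ 2)"
    unfolding r_def by (rule infsum_cong_neutral) auto
  finally have "infsum r UNIV = G2" by (simp add: eisenstein_G2_def r_def)
  thus ?thesis unfolding 1 2 row by (simp add: infsum_uminus)
qed

section \<open>Reduction of the integrand and its primitive\<close>

definition disc :: complex where "disc = 20 * G4 ^ 3 - 49 * G6 ^ 2"

lemma disc_nonzero: "disc \<noteq> 0"
  using discriminant_nonzero by (simp add: disc_def)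

text \<open>Both quadratic polynomials come from the Bezout relation between the cubic
  \<open>4 * x ^ 3 - 60 * G4 * x - 140 * G6\<close> and its derivative.\<close>

definition u :: "complex \<Rightarrow> complex" where
  "u x = G4 / (15 * disc) * x ^ 2 - 7 * G6 / (30 * disc) * x - 2 * G4 ^ 2 / (3 * disc)"

definition v :: "complex \<Rightarrow> complex" where
  "v x = - 7 * G6 / (30 * disc) * x ^ 2 + G4 ^ 2 / (3 * disc) * x + 7 * G4 * G6 / (3 * disc)"

text \<open>The second factor is half the derivative of the cubic, which is \<open>wp''\<close> at x
  = \<open>wp\<close>. The cofactor of the cubic is displayed as a linear polynomial minus the
  derivative of \<open>u\<close>, because that linear polynomial is what remains of
  1/\<open>wp'\<close>^2 modulo derivatives.\<close>

lemma bezout_u: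
  "1 = (G4 / (30 * disc) * x + 7 * G6 / (60 * disc) - (2 * G4 / (15 * disc) * x - 7 * G6 / (30 * disc))) *
         (4 * x ^ 3 - 60 * G4 * x - 140 * G6) + u x * (6 * x ^ 2 - 30 * G4)"
proof -
  have "60 * disc = (2 * G4 * x + 7 * G6 - (8 * G4 * x - 14 * G6)) * (4 * x ^ 3 - 60 * G4 * x - 140 * G6) +
     (4 * G4 * x ^ 2 - 14 * G6 * x - 40 * G4 ^ 2) * (6 * x ^ 2 - 30 * G4)"
    unfolding disc_def by algebra
  also have "\<dots> = 60 * disc * ((G4 / (30 * disc) * x + 7 * G6 / (60 * disc) - (2 * G4 / (15 * disc) * x - 7 * G6 / (30 * disc))) *
         (4 * x ^ 3 - 60 * G4 * x - 140 * G6) + u x * (6 * x ^ 2 - 30 * G4))"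
    using disc_nonzero by (simp add: u_def field_simps)
  finally show ?thesis using disc_nonzero by simp
qed

text \<open>The analogue for x/\<open>wp'\<close>^2. Its linear coefficient is the negative of the
  constant coefficient in \<open>bezout_u\<close>, which is why \<open>G6\<close> drops out of the
  numerator of the integral.\<close>

lemma bezout_v:
  "x = (- 7 * G6 / (60 * disc) * x - G4 ^ 2 / (6 * disc) - (- 7 * G6 / (15 * disc) * x + G4 ^ 2 / (3 * disc))) *
         (4 * x ^ 3 - 60 * G4 * x - 140 * G6) + v x * (6 * x ^ 2 - 30 * G4)"
proof -
  have "60 * disc * x = (- 7 * G6 * x - 10 * G4 ^ 2 - (- 28 * G6 * x + 20 * G4 ^ 2)) * (4 * x ^ 3 - 60 * G4 * x - 140 * G6) +
     (- 14 * G6 * x ^ 2 + 20 * G4 ^ 2 * x + 140 * G4 * G6) * (6 * x ^ 2 - 30 * G4)"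
    unfolding disc_def by algebra
  also have "\<dots> = 60 * disc * ((- 7 * G6 / (60 * disc) * x - G4 ^ 2 / (6 * disc) - (- 7 * G6 / (15 * disc) * x + G4 ^ 2 / (3 * disc))) *
         (4 * x ^ 3 - 60 * G4 * x - 140 * G6) + v x * (6 * x ^ 2 - 30 * G4))"
    using disc_nonzero by (simp add: v_def field_simps)
  finally show ?thesis using disc_nonzero by simp
qed

text \<open>The first two quotients are the elliptic part. \<open>1 / z + Z z\<close> is a primitive
  of \<open>- wp\<close>, so the last two terms integrate the remaining linear polynomial in
  \<open>wp\<close>.\<close>

definition primitive :: "complex \<Rightarrow> complex" where
  "primitive z = (v (wp z) - G2 * u (wp z)) / wp' z - wp'' z / (12 * wp' z ^ 3)
     - (G2 * G4 / (30 * disc) + 7 * G6 / (60 * disc)) * (1 / z + Z z)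
     + (G2 * (7 * G6 / (60 * disc)) + G4 ^ 2 / (6 * disc)) * z"

lemma primitive_has_field_derivative:
  assumes "2 * z \<notin> \<Lambda>"
  shows "(primitive has_field_derivative P2 \<tau> (2 * z) / wp' z ^ 2) (at z)"
proof -
  have z: "z \<notin> \<Lambda>" using assms double_in_lattice by blast
  define x y where "x = wp z" and "y = wp' z"
  have y: "y \<noteq> 0" using wp'_nonzero[OF assms] by (simp add: y_def)
  have y2: "y ^ 2 = 4 * x ^ 3 - 60 * G4 * x - 140 * G6" using wp'_power2[OF z] by (simp add: x_def y_def)
  have w: "wp'' z = 6 * x ^ 2 - 30 * G4" using wp''_eq[OF z] by (simp add: x_def)
  define a b where "a = G4 / (30 * disc)" and "b = 7 * G6 / (60 * disc)"
  define du where "du = 2 * G4 / (15 * disc) * x - 7 * G6 / (30 * disc)"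
  define dv where "dv = - 7 * G6 / (15 * disc) * x + G4 ^ 2 / (3 * disc)"
  define d where "d = G4 ^ 2 / (6 * disc)"
  have bu: "1 = (a * x + b - du) * y ^ 2 + u x * wp'' z"
    unfolding y2 w a_def b_def du_def by (rule bezout_u)
  have bv: "x = (- b * x - d - dv) * y ^ 2 + v x * wp'' z"
    unfolding y2 w b_def d_def dv_def using bezout_v[of x] by simp
  have du: "(u has_field_derivative du) (at (wp z))"
    unfolding u_def du_def x_def using disc_nonzero by (auto intro!: derivative_eq_intros)
  have dv: "(v has_field_derivative dv) (at (wp z))"
    unfolding v_def dv_def x_def using disc_nonzero by (auto intro!: derivative_eq_intros)
  have D: "((\<lambda>z. u (wp z)) has_field_derivative du * y) (at z)"
          "((\<lambda>z. v (wp z)) has_field_derivative dv * y) (at z)"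
    using DERIV_chain2[OF du wp_has_field_derivative[OF z]]
          DERIV_chain2[OF dv wp_has_field_derivative[OF z]] by (simp_all add: y_def)
  have "z \<noteq> 0" using z by auto
  have D1: "((\<lambda>z. (v (wp z) - G2 * u (wp z)) / wp' z) has_field_derivative
      (dv - G2 * du) - (v x - G2 * u x) * wp'' z / y ^ 2) (at z)"
    using y
    by (auto intro!: derivative_eq_intros D wp'_has_field_derivative[OF z]
             simp: x_def[symmetric] y_def[symmetric] field_simps power2_eq_square)
  have D2: "((\<lambda>z. wp'' z / (12 * wp' z ^ 3)) has_field_derivative
      x / y ^ 2 - wp'' z ^ 2 / (4 * y ^ 4)) (at z)"
    using y
    by (auto intro!: derivative_eq_intros wp'_has_field_derivative[OF z] wp''_has_field_derivative[OF z]
             simp: x_def[symmetric] y_def[symmetric])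
       (simp add: field_simps eval_nat_numeral)
  have D3: "((\<lambda>z. 1 / z + Z z) has_field_derivative - x) (at z)"
    using DERIV_add[OF inverse_power_has_field_derivative[OF \<open>z \<noteq> 0\<close>, of 1] Z_deriv[of z]] z
    by (simp add: x_def weierstrass_p_eq power2_eq_square)
  have "(primitive has_field_derivative
      ((dv - G2 * du) - (v x - G2 * u x) * wp'' z / y ^ 2) - (x / y ^ 2 - wp'' z ^ 2 / (4 * y ^ 4))
      - (G2 * a + b) * (- x) + (G2 * b + d) * 1) (at z)"
    unfolding primitive_def[abs_def] a_def[symmetric] b_def[symmetric] d_def[symmetric]
      times_divide_eq_right[symmetric, of G2 G4]
    by (intro DERIV_add DERIV_diff D1 D2 DERIV_cmult D3 DERIV_ident)
  also have "((dv - G2 * du) - (v x - G2 * u x) * wp'' z / y ^ 2) - (x / y ^ 2 - wp'' z ^ 2 / (4 * y ^ 4))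
      - (G2 * a + b) * (- x) + (G2 * b + d) * 1 = P2 \<tau> (2 * z) / y ^ 2"
  proof -
    \<comment> \<open>In these four quantities, the duplication formula and the Bezout relations
      divided by y^2 become linear, and so does the goal.\<close>
    define X U V W where "X = x / y ^ 2" and "U = u x * wp'' z / y ^ 2"
      and "V = v x * wp'' z / y ^ 2" and "W = wp'' z ^ 2 / (4 * y ^ 4)"
    have y4: "4 * y ^ 4 = (4 * y ^ 2) * y ^ 2" by simp
    have P: "P2 \<tau> (2 * z) / y ^ 2 = W - 2 * X + G2 * (1 / y ^ 2)"
      unfolding P2_def wp_double[OF assms] W_def X_def y4 x_def y_def
      by (simp add: power_divide power_mult_distrib add_divide_distrib diff_divide_distrib)
    have I: "1 / y ^ 2 = a * x + b - du + U"
      using y by (subst bu) (simp add: U_def add_divide_distrib)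
    have "X = - b * x - d - dv + V"
      unfolding X_def using y by (subst bv) (simp add: V_def add_divide_distrib)
    hence dv_eq: "dv = V - b * x - d - X" by (simp add: algebra_simps)
    have UV: "(v x - G2 * u x) * wp'' z / y ^ 2 = V - G2 * U"
      by (simp add: U_def V_def diff_divide_distrib left_diff_distrib)
    show ?thesis
      unfolding P I UV dv_eq X_def[symmetric] W_def[symmetric] by (simp add: algebra_simps)
  qed
  finally show ?thesis by (simp add: y_def)
qed

text \<open>The elliptic part cancels; the zeta term contributes its quasi-period and the linear
  term its slope.\<close>

lemma primitive_period:
  assumes "2 * z \<notin> \<Lambda>"
  shows "primitive (z + 1) - primitive z = G4 * (5 * G4 - G2 ^ 2) / (30 * disc)"
proof -
  have z: "z \<notin> \<Lambda>" using assms double_in_lattice by blast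
  define R where "R = (v (wp z) - G2 * u (wp z)) / wp' z - wp'' z / (12 * wp' z ^ 3)"
  define a b where "a = G2 * G4 / (30 * disc) + 7 * G6 / (60 * disc)"
    and "b = G2 * (7 * G6 / (60 * disc)) + G4 ^ 2 / (6 * disc)"
  have p: "primitive z = R - a * (1 / z + Z z) + b * z"
    by (simp only: primitive_def R_def a_def b_def)
  have p1: "primitive (z + 1) = R - a * (1 / (z + 1) + Z (z + 1)) + b * (z + 1)"
    by (simp only: primitive_def R_def a_def b_def wp_periodic[OF z lattice_1]
          wp'_periodic[OF z lattice_1] wp''_periodic[OF z lattice_1])
  have "primitive (z + 1) - primitive z = a * (1 / z + Z z - (1 / (z + 1) + Z (z + 1))) + b"
    unfolding p p1 by (simp add: right_diff_distrib distrib_left)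
  also have "\<dots> = a * (- G2) + b" unfolding zeta_quasi_period[OF z] ..
  also have "\<dots> = G4 * (5 * G4 - G2 ^ 2) / (30 * disc)"
    unfolding a_def b_def using disc_nonzero by (simp add: field_simps power2_eq_square)
  finally show ?thesis .
qed

text \<open>Zeros of \<open>wp'\<close> are half periods, whose imaginary parts are integer
  multiples of \<open>Im \<tau> / 2\<close>; the open strip between two consecutive levels avoids
  them.\<close>

lemma double_strip_notin_lattice:
  assumes "0 < Im z" "Im z < Im \<tau> / 2"
  shows "2 * z \<notin> \<Lambda>"
proof
  assume "2 * z \<in> \<Lambda>"
  then obtain m n :: int where "2 * z = of_int m + of_int n * \<tau>" unfolding lattice_def by blast
  hence "Im (2 * z) = Im (of_int m + of_int n * \<tau>)" by simp
  hence *: "2 * Im z = of_int n * Im \<tau>" by simp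
  have "0 < of_int n * Im \<tau>" "of_int n * Im \<tau> < 1 * Im \<tau>" using assms * by linarith+
  hence "0 < n" "n < 1"
    using Im_pos by (simp_all add: zero_less_mult_iff)
  thus False by linarith
qed

theorem A_cycle_integral:
  assumes "0 < \<epsilon>" "\<epsilon> < Im \<tau> / 2"
  shows "((\<lambda>z. P2 \<tau> (2 * z) / (deriv wp z) ^ 2) has_contour_integral
           G4 * (5 * G4 - G2 ^ 2) / (30 * (20 * G4 ^ 3 - 49 * G6 ^ 2))) (A_cycle \<epsilon>)"
proof -
  define S where "S = {z. Im z = \<epsilon>}"
  have S: "2 * z \<notin> \<Lambda>" if "z \<in> S" for z
    using that assms by (intro double_strip_notin_lattice) (auto simp: S_def)
  have path: "path_image (A_cycle \<epsilon>) \<subseteq> S"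
    by (auto simp: A_cycle_def S_def closed_segment_def algebra_simps)
  have "((\<lambda>z. P2 \<tau> (2 * z) / (deriv wp z) ^ 2) has_contour_integral
      primitive (pathfinish (A_cycle \<epsilon>)) - primitive (pathstart (A_cycle \<epsilon>))) (A_cycle \<epsilon>)"
  proof (rule contour_integral_primitive[OF _ _ path])
    fix z assume "z \<in> S"
    hence 2: "2 * z \<notin> \<Lambda>" by (rule S)
    hence "z \<notin> \<Lambda>" using double_in_lattice by blast
    hence "deriv wp z = wp' z" by (intro DERIV_imp_deriv wp_has_field_derivative)
    thus "(primitive has_field_derivative P2 \<tau> (2 * z) / (deriv wp z) ^ 2) (at z within S)"
      using primitive_has_field_derivative[OF 2] by (simp add: has_field_derivative_at_within)
  qed (simp add: A_cycle_def)
  moreover have "primitive (pathfinish (A_cycle \<epsilon>)) - primitive (pathstart (A_cycle \<epsilon>)) =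
      G4 * (5 * G4 - G2 ^ 2) / (30 * (20 * G4 ^ 3 - 49 * G6 ^ 2))"
    using primitive_period[OF S, of "\<i> * of_real \<epsilon>"]
    by (simp add: A_cycle_def S_def disc_def add.commute)
  ultimately show ?thesis by simp
qed

end

text \<open>The bound on \<epsilon> makes "small" explicit: the first poles above the real axis are
  the half periods at height \<open>Im \<tau> / 2\<close>, and those at height 0 force \<epsilon> to
  be positive.\<close>

theorem corollary5p1:
  fixes \<tau> :: complex and \<epsilon> :: real
  assumes "Im \<tau> > 0"
    and "0 < \<epsilon>" and "\<epsilon> < Im \<tau> / 2"
  shows "((\<lambda>z. P2 \<tau> (2 * z) / (deriv (weierstrass_p \<tau>) z) ^ 2) has_contour_integral
           eisenstein_G 4 \<tau> * (5 * eisenstein_G 4 \<tau> - eisenstein_G2 \<tau> ^ 2) /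
             (30 * (20 * eisenstein_G 4 \<tau> ^ 3 - 49 * eisenstein_G 6 \<tau> ^ 2)))
         (A_cycle \<epsilon>)"
proof -
  interpret upper_half_plane \<tau> by standard fact
  show ?thesis using assms(2,3) by (rule A_cycle_integral)
qed

end
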